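(* For $t\in\mathbb{N}$ let $$\mathcal{U}_t(a;q)=\sum_{1\le n_1<n_2<\cdots<n_t}\frac{q^{n_1+n_2+\cdots+n_t}}{(1+aq^{n_1}+q^{2n_1})(1+aq^{n_2}+q^{2n_2})\cdots(1+aq^{n_t}+q^{2n_t})},\qquad q=e^{2\pi i\tau},\ \tau\in\mathbb{H}.$$ Then $\mathcal{U}_t(a;q)$ is a linear combination of quasimodular forms of weight $\le t$ on the group $\Gamma_0(4)$ for $a=0$, on $\Gamma_0(3)$ for $a=1$, and on $\Gamma_0(6)$ for $a=-1$.
   Context: $\mathbb{N}=\{1,2,3,\ldots\}$; $\mathbb{H}$ is the complex upper half-plane; $\Gamma_0(N)=\{\begin{pmatrix}a&b\\c&d\end{pmatrix}\in\mathrm{SL}_2(\mathbb{Z}): c\equiv0 \pmod N\}$. A holomorphic function $g:\mathbb{H}\to\mathbb{C}$ is a quasimodular form of weight $w\in\mathbb{Z}$, depth $h\ge 0$ and Dirichlet character $\chi$ (modulo $N$) on $\Gamma_0(N)$ if there are holomorphic $g_0,\ldots,g_h:\mathbb{H}\to\mathbb{C}$, $g_h\ne0$, with $$g\Big(\frac{a\tau+b}{c\tau+d}\Big)=\chi(d)(c\tau+d)^{w}\sum_{j=0}^h g_j(\tau)\Big(\frac{c}{c\tau+d}\Big)^j\quad\text{for all }\begin{pmatrix}a&b\\c&d\end{pmatrix}\in\Gamma_0(N),$$ and such that $(c\tau+d)^{-(w-2r)}g_r\big(\frac{a\tau+b}{c\tau+d}\big)$ is bounded as $\mathrm{Im}(\tau)\to\infty$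 for all $r\in\{0,\ldots,h\}$ and all $\begin{pmatrix}a&b\\c&d\end{pmatrix}\in\mathrm{SL}_2(\mathbb{Z})$. The zero function is also counted as quasimodular of every weight. "Quasimodular form on $\Gamma_0(N)$" means quasimodular with some Dirichlet character modulo $N$; different terms in the linear combination may have different weights and characters, and constants (weight $0$) are allowed. *)

theory Defs
  imports "HOL-Complex_Analysis.Complex_Analysis"
begin

definition upper_half_plane :: "complex set" ("\<H>") where
  "\<H> = {\<tau>. Im \<tau> > 0}"

text \<open>A quadruple \<open>(a, b, c, d)\<close> stands for the matrix with rows \<open>(a, b)\<close> and \<open>(c, d)\<close>.\<close>

type_synonym mat2 = "int \<times> int \<times> int \<times> int"

definition SL2Z :: "mat2 set" where
  "SL2Z = {(a, b, c, d). a * d - b * c = 1}"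

definition Gamma0 :: "nat \<Rightarrow> mat2 set" where
  "Gamma0 N = {(a, b, c, d). (a, b, c, d) \<in> SL2Z \<and> int N dvd c}"

definition moebius :: "mat2 \<Rightarrow> complex \<Rightarrow> complex" where
  "moebius = (\<lambda>(a, b, c, d) \<tau>. (of_int a * \<tau> + of_int b) / (of_int c * \<tau> + of_int d))"

definition dirichlet_character :: "nat \<Rightarrow> (int \<Rightarrow> complex) \<Rightarrow> bool" where
  "dirichlet_character N chi \<longleftrightarrow>
     (\<forall>m n. chi (m * n) = chi m * chi n) \<and>
     (\<forall>m. chi (m + int N) = chi m) \<and>
     (\<forall>m. chi m = 0 \<longleftrightarrow> \<not> coprime m (int N))"

text \<open>
  Functions on the upper half-plane are represented by functions on \<open>complex\<close> whose values
  outside \<open>\<H>\<close> are irrelevant; in particular \<open>g\<^sub>h \<noteq> 0\<close> means that \<open>g\<^sub>h\<close> is not identically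
  zero on \<open>\<H>\<close>. The filter \<open>filtercomap Im at_top\<close> expresses \<open>Im \<tau> \<rightarrow> \<infinity>\<close>, uniformly in
  \<open>Re \<tau>\<close>.
\<close>

definition quasimodular_of ::
    "int \<Rightarrow> nat \<Rightarrow> (int \<Rightarrow> complex) \<Rightarrow> nat \<Rightarrow> (complex \<Rightarrow> complex) \<Rightarrow> bool" where
  "quasimodular_of w h chi N g \<longleftrightarrow>
     g holomorphic_on \<H> \<and>
     (\<exists>G :: nat \<Rightarrow> complex \<Rightarrow> complex.
        (\<forall>j\<le>h. G j holomorphic_on \<H>) \<and>
        (\<exists>\<tau>\<in>\<H>. G h \<tau> \<noteq> 0) \<and>
        (\<forall>(a, b, c, d) \<in> Gamma0 N. \<forall>\<tau>\<in>\<H>.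
           g (moebius (a, b, c, d) \<tau>) =
             chi d * (of_int c * \<tau> + of_int d) powi w *
             (\<Sum>j\<le>h. G j \<tau> * (of_int c / (of_int c * \<tau> + of_int d)) ^ j)) \<and>
        (\<forall>r\<le>h. \<forall>(a, b, c, d) \<in> SL2Z.
           Bfun (\<lambda>\<tau>. (of_int c * \<tau> + of_int d) powi (- (w - 2 * int r)) *
                      G r (moebius (a, b, c, d) \<tau>))
                (filtercomap Im at_top)))"

definition quasimodular_form :: "int \<Rightarrow> nat \<Rightarrow> (complex \<Rightarrow> complex) \<Rightarrow> bool" where
  "quasimodular_form w N g \<longleftrightarrow>
     (\<forall>\<tau>\<in>\<H>. g \<tau> = 0) \<or>
     (\<exists>h chi. dirichlet_character N chi \<and> quasimodular_of w h chi N g)"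

definition quasimodular_lincomb :: "int \<Rightarrow> nat \<Rightarrow> (complex \<Rightarrow> complex) \<Rightarrow> bool" where
  "quasimodular_lincomb k N F \<longleftrightarrow>
     (\<exists>(m :: nat) (\<alpha> :: nat \<Rightarrow> complex) (f :: nat \<Rightarrow> complex \<Rightarrow> complex) (w :: nat \<Rightarrow> int).
        (\<forall>i<m. w i \<le> k \<and> quasimodular_form (w i) N (f i)) \<and>
        (\<forall>\<tau>\<in>\<H>. F \<tau> = (\<Sum>i<m. \<alpha> i * f i \<tau>)))"

text \<open>
  The list \<open>[n\<^sub>1, \<dots>, n\<^sub>t]\<close> represents the summation index. For \<open>\<bar>q\<bar> < 1\<close> and real \<open>a\<close> with
  \<open>\<bar>a\<bar> \<le> 2\<close> the zeros of \<open>1 + a x + x\<^sup>2\<close> lie on the unit circle, so no denominator vanishes and the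
  series converges absolutely; then \<open>infsum\<close> is its actual value.
\<close>

definition increasing_tuples :: "nat \<Rightarrow> nat list set" where
  "increasing_tuples t = {ns. length ns = t \<and> sorted_wrt (<) ns \<and> (\<forall>n\<in>set ns. 1 \<le> n)}"

definition MacMahon_U :: "nat \<Rightarrow> complex \<Rightarrow> complex \<Rightarrow> complex" where
  "MacMahon_U t a q =
     (\<Sum>\<^sub>\<infinity>ns\<in>increasing_tuples t.
        q ^ sum_list ns / (\<Prod>n\<leftarrow>ns. 1 + a * q ^ n + q ^ (2 * n)))"

end

theory Submission
  imports Defs
begin

text \<open>
  Put \<open>a = -2 cos (2 \<pi> z)\<close> and \<open>x\<^sub>n = q\<^sup>n / (1 + a q\<^sup>n + q\<^sup>2\<^sup>n)\<close>, so that \<open>a = 0, 1, -1\<close> belong to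
  \<open>z = 1/4, 1/3, 1/6\<close>. The series \<open>U\<^sub>t\<close> is the \<open>t\<close>-th elementary symmetric function of the \<open>x\<^sub>n\<close>.
  By Newton's identities (\<open>newton_infsum\<close>) it is a polynomial in the power sums
  \<open>P\<^sub>k = \<Sum>\<^sub>n x\<^sub>n\<^sup>k\<close>, isobaric of degree \<open>t\<close>. Products of quasimodular forms are
  quasimodular (\<open>quasimodular_form_mult\<close>), so it is enough that \<open>P\<^sub>k\<close> is a linear combination of
  quasimodular forms of weight at most \<open>k\<close>.

  The power sums come from one function. Let \<open>E\<^sub>1(z) = \<Sum>\<^sub>m \<Sum>\<^sub>n 1 / (z + m \<tau> + n)\<close>, summed in Eisenstein's
  order: the inner sum gives \<open>\<pi> cot (\<pi> (z + m \<tau>))\<close>, and the outer one pairs \<open>m\<close> with \<open>-m\<close>. Adding the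
  two cotangents of a pair shows \<open>E\<^sub>1(z) = \<pi> cot (\<pi> z) + 4 \<pi> sin (2 \<pi> z) P\<^sub>1\<close> near the real axis, and
  \<open>d P\<^sub>k / d a = - k P\<^sub>k\<^sub>+\<^sub>1\<close>. Hence the \<open>k\<close>-th derivative of \<open>E\<^sub>1\<close> in \<open>z\<close> is a combination of
  \<open>1, P\<^sub>1, \<dots>, P\<^sub>k\<^sub>+\<^sub>1\<close> whose coefficients depend on \<open>z\<close> only and whose last coefficient does not
  vanish (\<open>higher_deriv_Eis1_eq\<close>). This triangular system can be solved for the power sums.

  The function \<open>E\<^sub>1\<close> is odd, has period \<open>1\<close>, drops by \<open>2 \<pi> \<i>\<close> under \<open>z \<mapsto> z + \<tau>\<close>, and has simple poles
  of residue \<open>1\<close> at the lattice points. For \<open>\<gamma> = (a, b; c, d)\<close> in \<open>SL\<^sub>2(\<int>)\<close> these properties determine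
  its transformation: the difference of the two sides of
  \<open>E\<^sub>1(z / (c \<tau> + d); \<gamma> \<tau>) = (c \<tau> + d) E\<^sub>1(z; \<tau>) + 2 \<pi> \<i> c z\<close>
  is entire, doubly periodic and odd, hence zero by Liouville's theorem (\<open>Eis1_moebius\<close>).

  Now differentiate \<open>k\<close> times in \<open>z\<close> and put \<open>z = (c \<tau> + d) / N\<close>, so that the left side is taken at
  \<open>1/N\<close>. If \<open>N\<close> divides \<open>c\<close> then \<open>(c \<tau> + d) / N\<close> is \<open>d / N\<close> up to a lattice point, and for
  \<open>N = 3, 4, 6\<close> every unit modulo \<open>N\<close> is \<open>1\<close> or \<open>-1\<close>; so this is \<open>1/N\<close> or \<open>-1/N\<close> up to the lattice, and
  parity gives the character. Therefore the \<open>k\<close>-th derivative of \<open>E\<^sub>1\<close> at \<open>1/N\<close> is modular of weight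
  \<open>k + 1\<close> on \<open>\<Gamma>\<^sub>0(N)\<close>, except that for \<open>k = 1\<close> the term \<open>2 \<pi> \<i> c z\<close> leaves a constant \<open>2 \<pi> \<i>\<close> in
  depth \<open>1\<close>; for \<open>k = 0\<close> it cancels against the quasi-period
  (\<open>quasimodular_form_higher_deriv_Eis1\<close>). At a cusp the same formula leads to the values
  at \<open>\<alpha> \<tau> + \<beta>\<close> with fixed real \<open>\<alpha>, \<beta>\<close>, and they are bounded because \<open>E\<^sub>1\<close> is bounded on a disc of
  fixed radius around such a point (\<open>higher_deriv_Eis1_bounded\<close>).
\<close>

section \<open>Elementary symmetric functions of a summable sequence\<close>

text \<open>
  The finite truncations of the index set: their union over \<open>M\<close> is the whole of it, and every finite
  set of tuples lies in one of them.
\<close>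

definition bounded_tuples :: "nat \<Rightarrow> nat \<Rightarrow> nat list set" where
  "bounded_tuples t M = {ns \<in> increasing_tuples t. \<forall>n\<in>set ns. n \<le> M}"

text \<open>
  The elementary symmetric polynomial \<open>e\<^sub>t(x\<^sub>1, \<dots>, x\<^sub>M)\<close>, given by the recursion on the last
  variable, because all inductions below add one variable at a time. The indices start at \<open>1\<close>.
\<close>

fun elem_sym :: "(nat \<Rightarrow> 'a :: comm_ring_1) \<Rightarrow> nat \<Rightarrow> nat \<Rightarrow> 'a" where
  "elem_sym x 0 M = 1"
| "elem_sym x (Suc t) 0 = 0"
| "elem_sym x (Suc t) (Suc M) = elem_sym x (Suc t) M + x (Suc M) * elem_sym x t M"

lemma bounded_tuples_0: "bounded_tuples 0 M = {[]}"
  by (auto simp: bounded_tuples_def increasing_tuples_def)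

lemma bounded_tuples_Suc_0: "bounded_tuples (Suc t) 0 = {}"
proof -
  have "False" if "ns \<in> bounded_tuples (Suc t) 0" for ns
    using that by (cases ns) (auto simp: bounded_tuples_def increasing_tuples_def)
  thus ?thesis by blast
qed

lemma bounded_tuples_Suc_Suc:
  "bounded_tuples (Suc t) (Suc M) =
     bounded_tuples (Suc t) M \<union> (\<lambda>ns. ns @ [Suc M]) ` bounded_tuples t M"
proof (intro equalityI subsetI)
  fix ns assume ns: "ns \<in> bounded_tuples (Suc t) (Suc M)"
  hence "ns \<noteq> []" by (auto simp: bounded_tuples_def increasing_tuples_def)
  then obtain ms m where [simp]: "ns = ms @ [m]" by (metis rev_exhaust)
  have *: "length ms = t" "sorted_wrt (<) ms" "\<forall>k\<in>set ms. k < m \<and> 1 \<le> k" "1 \<le> m" "m \<le> Suc M"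
    using ns by (auto simp: bounded_tuples_def increasing_tuples_def sorted_wrt_append)
  show "ns \<in> bounded_tuples (Suc t) M \<union> (\<lambda>ns. ns @ [Suc M]) ` bounded_tuples t M"
  proof (cases "m = Suc M")
    case True
    hence "ms \<in> bounded_tuples t M"
      using * by (auto simp: bounded_tuples_def increasing_tuples_def less_Suc_eq_le)
    thus ?thesis using True by simp
  next
    case False
    thus ?thesis using *
      by (fastforce simp: bounded_tuples_def increasing_tuples_def sorted_wrt_append)
  qed
next
  fix ns assume "ns \<in> bounded_tuples (Suc t) M \<union> (\<lambda>ns. ns @ [Suc M]) ` bounded_tuples t M"
  thus "ns \<in> bounded_tuples (Suc t) (Suc M)"
    by (fastforce simp: bounded_tuples_def increasing_tuples_def sorted_wrt_append less_Suc_eq_le)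
qed

lemma finite_bounded_tuples [simp]: "finite (bounded_tuples t M)"
proof -
  have "bounded_tuples t M \<subseteq> {ns. set ns \<subseteq> {..M} \<and> length ns = t}"
    by (auto simp: bounded_tuples_def increasing_tuples_def)
  thus ?thesis using finite_lists_length_eq[of "{..M}" t] finite_subset by blast
qed

lemma sum_bounded_tuples:
  "(\<Sum>ns\<in>bounded_tuples t M. prod_list (map x ns)) = elem_sym x t M"
proof (induction x t M rule: elem_sym.induct)
  case (3 x t M)
  have "bounded_tuples (Suc t) M \<inter> (\<lambda>ns. ns @ [Suc M]) ` bounded_tuples t M = {}"
    by (auto simp: bounded_tuples_def)
  hence "(\<Sum>ns\<in>bounded_tuples (Suc t) (Suc M). prod_list (map x ns)) =
    elem_sym x (Suc t) M +
    (\<Sum>ns\<in>(\<lambda>ns. ns @ [Suc M]) ` bounded_tuples t M. prod_list (map x ns))"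
    unfolding bounded_tuples_Suc_Suc by (subst sum.union_disjoint) (auto simp: 3)
  also have "(\<Sum>ns\<in>(\<lambda>ns. ns @ [Suc M]) ` bounded_tuples t M. prod_list (map x ns)) =
    x (Suc M) * elem_sym x t M"
    by (subst sum.reindex)
       (auto simp: inj_on_def 3(2)[symmetric] sum_distrib_left mult.commute intro!: sum.cong)
  finally show ?case by simp
qed (auto simp: bounded_tuples_0 bounded_tuples_Suc_0)

text \<open>
  Every term of \<open>e\<^sub>t\<close> occurs in the expansion of the power. For a summable sequence the bound is uniform
  in \<open>M\<close>, which gives absolute convergence of the series over all tuples.
\<close>

lemma elem_sym_nonneg_le_power:
  fixes x :: "nat \<Rightarrow> real"
  assumes "\<And>n. x n \<ge> 0"
  shows "0 \<le> elem_sym x t M \<and> elem_sym x t M \<le> (\<Sum>n<M. x (Suc n)) ^ t"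
  using assms
proof (induction x t M rule: elem_sym.induct)
  case (3 x t M)
  note assms = "3.prems"
  note IH = "3.IH"(1)[OF assms] "3.IH"(2)[OF assms]
  let ?s = "\<Sum>n<M. x (Suc n)"
  have s: "?s \<ge> 0" using assms by (simp add: sum_nonneg)
  have "elem_sym x (Suc t) (Suc M) \<le> ?s ^ Suc t + x (Suc M) * ?s ^ t"
    using IH assms[of "Suc M"] by (simp add: add_mono mult_left_mono)
  also have "\<dots> = (?s + x (Suc M)) * ?s ^ t"
    by (simp add: algebra_simps)
  also have "\<dots> \<le> (?s + x (Suc M)) * (?s + x (Suc M)) ^ t"
    using s assms[of "Suc M"] by (intro mult_left_mono power_mono) auto
  finally show ?case using IH assms[of "Suc M"] by simp
qed auto

text \<open>
  Newton's identities, by induction on the number of variables. Adding a variable \<open>y\<close> replaces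
  \<open>e\<^sub>k\<close> by \<open>e\<^sub>k + y e\<^sub>k\<^sub>-\<^sub>1\<close> and \<open>p\<^sub>i\<close> by \<open>p\<^sub>i + y\<^sup>i\<close>; the terms with a power of \<open>y\<close> from both factors
  telescope.
\<close>

lemma newton_elem_sym:
  fixes x :: "nat \<Rightarrow> 'a :: comm_ring_1"
  shows "of_nat t * elem_sym x t M =
    (\<Sum>i<t. (-1) ^ i * elem_sym x (t - Suc i) M * (\<Sum>n<M. x (Suc n) ^ Suc i))"
proof (induction M arbitrary: t)
  case 0
  thus ?case by (cases t) auto
next
  case (Suc M)
  show ?case
  proof (cases t)
    case [simp]: (Suc s)
    define y where "y = x (Suc M)"
    define p where "p i = (\<Sum>n<M. x (Suc n) ^ Suc i)" for i
    define e where "e k = elem_sym x k M" for k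
    \<comment> \<open>\<open>E k\<close> is \<open>e\<close> at the index \<open>k - 1\<close>, with the value \<open>0\<close> at index \<open>-1\<close>.\<close>
    define E where "E k = (case k of 0 \<Rightarrow> 0 | Suc j \<Rightarrow> e j)" for k
    \<comment> \<open>The telescoping terms.\<close>
    define u where "u i = (-1) ^ i * E (Suc s - i) * y ^ Suc i" for i
    have step: "elem_sym x k (Suc M) = e k + y * E k" for k
      by (cases k) (auto simp: e_def E_def y_def)
    have E_Suc: "E (Suc s - i) = e (s - i)" if "i \<le> s" for i
      using that by (simp add: E_def Suc_diff_le)
    have "(\<Sum>i<Suc s. (-1) ^ i * elem_sym x (s - i) (Suc M) * (\<Sum>n<Suc M. x (Suc n) ^ Suc i))
        = (\<Sum>i<Suc s. (-1) ^ i * (e (s - i) + y * E (s - i)) * (p i + y ^ Suc i))"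
      by (simp add: step p_def y_def)
    also have "\<dots> = (\<Sum>i<Suc s. (-1) ^ i * e (s - i) * p i)
        + y * (\<Sum>i<Suc s. (-1) ^ i * E (s - i) * p i) + (\<Sum>i<Suc s. u i - u (Suc i))"
      unfolding sum_distrib_left sum.distrib[symmetric]
      by (intro sum.cong refl) (simp add: u_def E_Suc less_Suc_eq_le algebra_simps)
    also have "(\<Sum>i<Suc s. u i - u (Suc i)) = y * e s"
      unfolding sum_lessThan_telescope' by (simp add: u_def E_def)
    also have "(\<Sum>i<Suc s. (-1) ^ i * e (s - i) * p i) = of_nat (Suc s) * e (Suc s)"
      using Suc.IH[of "Suc s"] by (simp add: e_def p_def)
    also have "(\<Sum>i<Suc s. (-1) ^ i * E (s - i) * p i) =
        (\<Sum>i<s. (-1) ^ i * e (s - Suc i) * p i)"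
    proof -
      have "E (s - i) = e (s - Suc i)" if "i < s" for i
        using that by (simp add: E_def split: nat.splits) (metis Suc_diff_Suc nat.inject)
      thus ?thesis by (simp add: E_def)
    qed
    also have "\<dots> = of_nat s * e s"
      using Suc.IH[of s] by (simp add: e_def p_def)
    finally show ?thesis
      by (simp add: step E_def e_def y_def algebra_simps)
  qed auto
qed

text \<open>
  The truncated index sets are cofinal among the finite sets of tuples, so the sums over them converge
  to the sum over all tuples as soon as the latter converges absolutely.
\<close>

lemma elem_sym_tendsto_infsum:
  fixes x :: "nat \<Rightarrow> 'a :: {real_normed_field, banach}"
  assumes "summable (\<lambda>n. norm (x (Suc n)))"
  shows "(\<lambda>M. elem_sym x t M) \<longlonglongrightarrow> (\<Sum>\<^sub>\<infinity>ns\<in>increasing_tuples t. prod_list (map x ns))"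
proof -
  define f where "f ns = prod_list (map x ns)" for ns
  have bounded: "\<exists>M. F \<subseteq> bounded_tuples t M" if "finite F" "F \<subseteq> increasing_tuples t" for F
  proof
    have "n \<le> Max (\<Union>ns\<in>F. set ns)" if "ns \<in> F" "n \<in> set ns" for n ns
      using that \<open>finite F\<close> by (intro Max_ge) auto
    thus "F \<subseteq> bounded_tuples t (Max (\<Union>ns\<in>F. set ns))"
      using that by (auto simp: bounded_tuples_def)
  qed
  have norm_f: "norm (f ns) = prod_list (map (\<lambda>n. norm (x n)) ns)" for ns
    by (induction ns) (auto simp: f_def norm_mult)
  have "sum (\<lambda>ns. norm (f ns)) F \<le> (\<Sum>n. norm (x (Suc n))) ^ t"
    if F: "finite F" "F \<subseteq> increasing_tuples t" for F
  proof -
    obtain M where "F \<subseteq> bounded_tuples t M" using bounded[OF F] by blast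
    hence "sum (\<lambda>ns. norm (f ns)) F \<le> sum (\<lambda>ns. norm (f ns)) (bounded_tuples t M)"
      by (intro sum_mono2) auto
    also have "\<dots> = elem_sym (\<lambda>n. norm (x n)) t M"
      by (simp add: norm_f sum_bounded_tuples)
    also have "\<dots> \<le> (\<Sum>n<M. norm (x (Suc n))) ^ t"
      using elem_sym_nonneg_le_power[of "\<lambda>n. norm (x n)"] by auto
    also have "\<dots> \<le> (\<Sum>n. norm (x (Suc n))) ^ t"
      using assms by (intro power_mono sum_le_suminf sum_nonneg) auto
    finally show ?thesis .
  qed
  hence "f abs_summable_on increasing_tuples t"
    by (intro nonneg_bdd_above_summable_on) (auto intro!: bdd_aboveI)
  hence "f summable_on increasing_tuples t"
    by (rule abs_summable_summable)
  hence "(f has_sum infsum f (increasing_tuples t)) (increasing_tuples t)"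
    by (rule has_sum_infsum)
  hence lim: "(sum f \<longlongrightarrow> infsum f (increasing_tuples t)) (finite_subsets_at_top (increasing_tuples t))"
    by (simp add: has_sum_def)
  have "filterlim (bounded_tuples t) (finite_subsets_at_top (increasing_tuples t)) sequentially"
    unfolding filterlim_finite_subsets_at_top
  proof (intro allI impI)
    fix F assume F: "finite F \<and> F \<subseteq> increasing_tuples t"
    then obtain M where M: "F \<subseteq> bounded_tuples t M" using bounded by blast
    have "F \<subseteq> bounded_tuples t M'" if "M' \<ge> M" for M'
      using M that by (force simp: bounded_tuples_def)
    moreover have "bounded_tuples t M' \<subseteq> increasing_tuples t" for M'
      by (auto simp: bounded_tuples_def)
    ultimately show "\<forall>\<^sub>F M in sequentially. finite (bounded_tuples t M) \<and>
        F \<subseteq> bounded_tuples t M \<and> bounded_tuples t M \<subseteq> increasing_tuples t"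
      by (auto simp: eventually_sequentially)
  qed
  from filterlim_compose[OF lim this] show ?thesis
    by (simp add: f_def[abs_def] sum_bounded_tuples)
qed

lemma newton_infsum:
  fixes x :: "nat \<Rightarrow> 'a :: {real_normed_field, banach}"
  assumes x: "summable (\<lambda>n. norm (x (Suc n)))"
  defines "e \<equiv> \<lambda>k. \<Sum>\<^sub>\<infinity>ns\<in>increasing_tuples k. prod_list (map x ns)"
  assumes "\<And>i. summable (\<lambda>n. x (Suc n) ^ Suc i)"
  shows "of_nat t * e t = (\<Sum>i<t. (-1) ^ i * e (t - Suc i) * (\<Sum>n. x (Suc n) ^ Suc i))"
proof (rule LIMSEQ_unique)
  show "(\<lambda>M. of_nat t * elem_sym x t M) \<longlonglongrightarrow> of_nat t * e t"
    unfolding e_def by (intro tendsto_intros elem_sym_tendsto_infsum x)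
  show "(\<lambda>M. of_nat t * elem_sym x t M) \<longlonglongrightarrow>
      (\<Sum>i<t. (-1) ^ i * e (t - Suc i) * (\<Sum>n. x (Suc n) ^ Suc i))"
    unfolding e_def newton_elem_sym
    by (intro tendsto_intros elem_sym_tendsto_infsum x summable_LIMSEQ assms)
qed

lemma MacMahon_U_eq:
  "MacMahon_U t a q =
     (\<Sum>\<^sub>\<infinity>ns\<in>increasing_tuples t. prod_list (map (\<lambda>n. q ^ n / (1 + a * q ^ n + q ^ (2 * n))) ns))"
proof -
  have "q ^ sum_list ns / (\<Prod>n\<leftarrow>ns. 1 + a * q ^ n + q ^ (2 * n)) =
      prod_list (map (\<lambda>n. q ^ n / (1 + a * q ^ n + q ^ (2 * n))) ns)" for ns
    by (induction ns) (simp_all add: power_add flip: times_divide_times_eq)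
  thus ?thesis by (simp add: MacMahon_U_def)
qed

section \<open>The algebra of quasimodular forms\<close>

lemma open_upper_half_plane: "open \<H>"
  unfolding upper_half_plane_def by (rule open_halfspace_Im_gt)

lemma connected_upper_half_plane: "connected \<H>"
  unfolding upper_half_plane_def by (intro convex_connected convex_halfspace_Im_gt)

lemma automorphy_factor_nonzero:
  assumes "(a, b, c, d) \<in> SL2Z" "Im \<tau> > 0"
  shows "of_int c * \<tau> + of_int d \<noteq> (0 :: complex)"
proof
  assume *: "of_int c * \<tau> + of_int d = (0 :: complex)"
  hence "Im (of_int c * \<tau> + of_int d) = 0" by simp
  hence "c = 0" using assms by simp
  with * have "d = 0" by simp
  with \<open>c = 0\<close> assms show False by (simp add: SL2Z_def)
qed

lemma Gamma0_subset_SL2Z: "Gamma0 N \<subseteq> SL2Z"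
  by (auto simp: Gamma0_def)

lemma eventually_Im_ge: "\<forall>\<^sub>F \<tau> in filtercomap Im at_top. Im \<tau> \<ge> Y"
  by (intro eventually_filtercomapI eventually_ge_at_top)

lemma Bfun_times:
  fixes f g :: "'a \<Rightarrow> 'b :: real_normed_algebra"
  assumes "Bfun f F" "Bfun g F"
  shows "Bfun (\<lambda>x. f x * g x) F"
proof -
  obtain A where A: "\<forall>\<^sub>F x in F. norm (f x) \<le> A" "A > 0" using assms(1) by (auto simp: Bfun_def)
  obtain B where B: "\<forall>\<^sub>F x in F. norm (g x) \<le> B" "B > 0" using assms(2) by (auto simp: Bfun_def)
  show ?thesis
  proof (rule BfunI)
    show "\<forall>\<^sub>F x in F. norm (f x * g x) \<le> A * B"
      using A(1) B(1)
    proof eventually_elim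
      case (elim x)
      have "norm (f x * g x) \<le> norm (f x) * norm (g x)" by (rule norm_mult_ineq)
      also have "\<dots> \<le> A * B" using elim A(2) by (intro mult_mono) auto
      finally show ?case .
    qed
  qed
qed

lemma Bfun_plus:
  fixes f g :: "'a \<Rightarrow> 'b :: real_normed_vector"
  assumes "Bfun f F" "Bfun g F"
  shows "Bfun (\<lambda>x. f x + g x) F"
proof -
  obtain A where A: "\<forall>\<^sub>F x in F. norm (f x) \<le> A" using assms(1) by (auto simp: Bfun_def)
  obtain B where B: "\<forall>\<^sub>F x in F. norm (g x) \<le> B" using assms(2) by (auto simp: Bfun_def)
  show ?thesis
    by (rule BfunI[of _ "A + B"], use A B in eventually_elim) (rule norm_triangle_mono)
qed

lemma Bfun_sum:
  fixes f :: "'i \<Rightarrow> 'a \<Rightarrow> 'b :: real_normed_vector"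
  assumes "\<And>i. i \<in> I \<Longrightarrow> Bfun (f i) F"
  shows "Bfun (\<lambda>x. \<Sum>i\<in>I. f i x) F"
  using assms
  by (induction I rule: infinite_finite_induct) (auto intro!: Bfun_plus)

lemma Bfun_cong_ev:
  fixes f g :: "'a \<Rightarrow> 'b :: real_normed_vector"
  assumes "\<forall>\<^sub>F x in F. f x = g x" "Bfun f F"
  shows "Bfun g F"
proof -
  obtain A where A: "\<forall>\<^sub>F x in F. norm (f x) \<le> A" using assms(2) by (auto simp: Bfun_def)
  show ?thesis
    by (rule BfunI[of _ A], use A assms(1) in eventually_elim) auto
qed

text \<open>
  The leading coefficients multiply, and a product of quasimodular forms must have a nonzero leading
  coefficient: the identity theorem makes the ring of holomorphic functions a domain.
\<close>

lemma holomorphic_product_nonzero: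
  assumes "open A" "connected A" "f holomorphic_on A" "g holomorphic_on A"
  assumes "\<exists>z\<in>A. f z \<noteq> 0" "\<exists>z\<in>A. g z \<noteq> 0"
  shows "\<exists>z\<in>A. f z * g z \<noteq> (0 :: complex)"
proof (rule ccontr)
  assume *: "\<not> (\<exists>z\<in>A. f z * g z \<noteq> 0)"
  obtain z0 where z0: "z0 \<in> A" "f z0 \<noteq> 0" using assms(5) by blast
  define B where "B = A \<inter> f -` (- {0})"
  have "open B" unfolding B_def
    using assms by (intro continuous_open_preimage holomorphic_on_imp_continuous_on) auto
  moreover have "B \<noteq> {}" "B \<subseteq> A" using z0 by (auto simp: B_def)
  moreover have "g z = 0" if "z \<in> B" for z using that * by (auto simp: B_def)
  ultimately have "g z = 0" if "z \<in> A" for z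
    using analytic_continuation_open[of B A g "\<lambda>_. 0" z] assms that by auto
  thus False using assms(6) by blast
qed

lemma dirichlet_character_mult:
  assumes "dirichlet_character N chi" "dirichlet_character N chi'"
  shows "dirichlet_character N (\<lambda>d. chi d * chi' d)"
  using assms by (auto simp: dirichlet_character_def)

lemma quasimodular_of_imp_holomorphic: "quasimodular_of w h chi N f \<Longrightarrow> f holomorphic_on \<H>"
  unfolding quasimodular_of_def by (rule conjunct1)

lemma quasimodular_ofE:
  assumes "quasimodular_of w h chi N f"
  obtains G where
    "\<And>j. j \<le> h \<Longrightarrow> G j holomorphic_on \<H>" "\<exists>\<tau>\<in>\<H>. G h \<tau> \<noteq> 0"
    "\<And>a b c d \<tau>. (a, b, c, d) \<in> Gamma0 N \<Longrightarrow> \<tau> \<in> \<H> \<Longrightarrow>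
       f (moebius (a, b, c, d) \<tau>) = chi d * (of_int c * \<tau> + of_int d) powi w *
         (\<Sum>j\<le>h. G j \<tau> * (of_int c / (of_int c * \<tau> + of_int d)) ^ j)"
    "\<And>r a b c d. r \<le> h \<Longrightarrow> (a, b, c, d) \<in> SL2Z \<Longrightarrow>
       Bfun (\<lambda>\<tau>. (of_int c * \<tau> + of_int d) powi (- (w - 2 * int r)) * G r (moebius (a, b, c, d) \<tau>))
            (filtercomap Im at_top)"
  using assms[unfolded quasimodular_of_def, THEN conjunct2]
proof (rule exE)
  fix G assume G: "(\<forall>j\<le>h. G j holomorphic_on \<H>) \<and>
        (\<exists>\<tau>\<in>\<H>. G h \<tau> \<noteq> 0) \<and>
        (\<forall>(a, b, c, d) \<in> Gamma0 N. \<forall>\<tau>\<in>\<H>.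
           f (moebius (a, b, c, d) \<tau>) =
             chi d * (of_int c * \<tau> + of_int d) powi w *
             (\<Sum>j\<le>h. G j \<tau> * (of_int c / (of_int c * \<tau> + of_int d)) ^ j)) \<and>
        (\<forall>r\<le>h. \<forall>(a, b, c, d) \<in> SL2Z.
           Bfun (\<lambda>\<tau>. (of_int c * \<tau> + of_int d) powi (- (w - 2 * int r)) *
                      G r (moebius (a, b, c, d) \<tau>))
                (filtercomap Im at_top))"
  show ?thesis
  proof (rule that[of G])
    show "f (moebius (a, b, c, d) \<tau>) = chi d * (of_int c * \<tau> + of_int d) powi w *
         (\<Sum>j\<le>h. G j \<tau> * (of_int c / (of_int c * \<tau> + of_int d)) ^ j)"
      if "(a, b, c, d) \<in> Gamma0 N" "\<tau> \<in> \<H>" for a b c d \<tau>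
      using G[THEN conjunct2, THEN conjunct2, THEN conjunct1, rule_format, OF that(1)] that(2) by simp
    show "Bfun (\<lambda>\<tau>. (of_int c * \<tau> + of_int d) powi (- (w - 2 * int r)) *
        G r (moebius (a, b, c, d) \<tau>)) (filtercomap Im at_top)"
      if "r \<le> h" "(a, b, c, d) \<in> SL2Z" for r a b c d
      using G[THEN conjunct2, THEN conjunct2, THEN conjunct2, rule_format, OF that]
      by simp
  qed (use G[THEN conjunct1] G[THEN conjunct2, THEN conjunct1] in simp_all)
qed

text \<open>
  The transformation law of a quasimodular form is a polynomial in \<open>c / (c \<tau> + d)\<close>; multiplying two
  such laws is multiplying polynomials, so depths, weights and characters add up. The coefficient of
  index \<open>r\<close> of the product is a sum of products of coefficients of indices \<open>k\<close> and \<open>r - k\<close>, whose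
  weights \<open>w - 2 k\<close> and \<open>w' - 2 (r - k)\<close> have the sum \<open>w + w' - 2 r\<close> that the growth condition asks
  for.
\<close>

lemma quasimodular_of_mult:
  assumes "quasimodular_of w h chi N f" "quasimodular_of w' h' chi' N f'"
  shows "quasimodular_of (w + w') (h + h') (\<lambda>d. chi d * chi' d) N (\<lambda>\<tau>. f \<tau> * f' \<tau>)"
proof -
  obtain G where G:
    "\<And>j. j \<le> h \<Longrightarrow> G j holomorphic_on \<H>" "\<exists>\<tau>\<in>\<H>. G h \<tau> \<noteq> 0"
    "\<And>a b c d \<tau>. (a, b, c, d) \<in> Gamma0 N \<Longrightarrow> \<tau> \<in> \<H> \<Longrightarrow>
       f (moebius (a, b, c, d) \<tau>) = chi d * (of_int c * \<tau> + of_int d) powi w *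
         (\<Sum>j\<le>h. G j \<tau> * (of_int c / (of_int c * \<tau> + of_int d)) ^ j)"
    "\<And>r a b c d. r \<le> h \<Longrightarrow> (a, b, c, d) \<in> SL2Z \<Longrightarrow>
       Bfun (\<lambda>\<tau>. (of_int c * \<tau> + of_int d) powi (- (w - 2 * int r)) * G r (moebius (a, b, c, d) \<tau>))
            (filtercomap Im at_top)"
    using assms(1) by (rule quasimodular_ofE) (rule that)
  obtain G' where G':
    "\<And>j. j \<le> h' \<Longrightarrow> G' j holomorphic_on \<H>" "\<exists>\<tau>\<in>\<H>. G' h' \<tau> \<noteq> 0"
    "\<And>a b c d \<tau>. (a, b, c, d) \<in> Gamma0 N \<Longrightarrow> \<tau> \<in> \<H> \<Longrightarrow>
       f' (moebius (a, b, c, d) \<tau>) = chi' d * (of_int c * \<tau> + of_int d) powi w' *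
         (\<Sum>j\<le>h'. G' j \<tau> * (of_int c / (of_int c * \<tau> + of_int d)) ^ j)"
    "\<And>r a b c d. r \<le> h' \<Longrightarrow> (a, b, c, d) \<in> SL2Z \<Longrightarrow>
       Bfun (\<lambda>\<tau>. (of_int c * \<tau> + of_int d) powi (- (w' - 2 * int r)) * G' r (moebius (a, b, c, d) \<tau>))
            (filtercomap Im at_top)"
    using assms(2) by (rule quasimodular_ofE) (rule that)
  \<comment> \<open>Continued by zero, so that coefficients of the product are plain convolutions.\<close>
  define K where "K j = (if j \<le> h then G j else (\<lambda>_. 0))" for j
  define K' where "K' j = (if j \<le> h' then G' j else (\<lambda>_. 0))" for j
  define P where "P r \<tau> = (\<Sum>k\<le>r. K k \<tau> * K' (r - k) \<tau>)" for r \<tau>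
  have K_holo: "K j holomorphic_on \<H>" "K' j holomorphic_on \<H>" for j
    using G(1) G'(1) by (auto simp: K_def K'_def)
  have K_bound: "Bfun (\<lambda>\<tau>. (of_int c * \<tau> + of_int d) powi (- (w - 2 * int r)) *
      K r (moebius (a, b, c, d) \<tau>)) (filtercomap Im at_top)" if "(a, b, c, d) \<in> SL2Z" for a b c d r
    using G(4)[OF _ that] by (cases "r \<le> h") (auto simp: K_def)
  have K'_bound: "Bfun (\<lambda>\<tau>. (of_int c * \<tau> + of_int d) powi (- (w' - 2 * int r)) *
      K' r (moebius (a, b, c, d) \<tau>)) (filtercomap Im at_top)" if "(a, b, c, d) \<in> SL2Z" for a b c d r
    using G'(4)[OF _ that] by (cases "r \<le> h'") (auto simp: K'_def)
  have top: "P (h + h') \<tau> = G h \<tau> * G' h' \<tau>" for \<tau>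
  proof -
    have "P (h + h') \<tau> = (\<Sum>k\<in>{h}. K k \<tau> * K' (h + h' - k) \<tau>)"
      unfolding P_def by (intro sum.mono_neutral_right) (auto simp: K_def K'_def)
    thus ?thesis by (simp add: K_def K'_def)
  qed
  show ?thesis
    unfolding quasimodular_of_def
  proof (intro conjI exI[of _ P] allI impI ballI; (clarify)?)
    show "(\<lambda>\<tau>. f \<tau> * f' \<tau>) holomorphic_on \<H>"
      by (intro holomorphic_intros assms[THEN quasimodular_of_imp_holomorphic])
    show "P j holomorphic_on \<H>" for j
      unfolding P_def[abs_def] by (intro holomorphic_intros K_holo)
    show "\<exists>\<tau>\<in>\<H>. P (h + h') \<tau> \<noteq> 0"
      unfolding top using G(1,2) G'(1,2)
      by (intro holomorphic_product_nonzero open_upper_half_plane connected_upper_half_plane) auto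
  next
    fix a b c d \<tau> assume *: "(a, b, c, d) \<in> Gamma0 N" "\<tau> \<in> \<H>"
    define l x where "l = of_int c * \<tau> + of_int d" and "x = of_int c / l"
    have l: "l \<noteq> 0"
      using automorphy_factor_nonzero[of a b c d \<tau>] * Gamma0_subset_SL2Z
      by (auto simp: upper_half_plane_def l_def)
    have "f (moebius (a, b, c, d) \<tau>) * f' (moebius (a, b, c, d) \<tau>) =
      (chi d * chi' d) * (l powi w * l powi w') *
        ((\<Sum>j\<le>h. K j \<tau> * x ^ j) * (\<Sum>j\<le>h'. K' j \<tau> * x ^ j))"
      by (simp add: G(3)[OF *] G'(3)[OF *] K_def K'_def l_def x_def)
    also have "l powi w * l powi w' = l powi (w + w')"
      using l by (simp add: power_int_add)
    also have "(\<Sum>j\<le>h. K j \<tau> * x ^ j) * (\<Sum>j\<le>h'. K' j \<tau> * x ^ j) = (\<Sum>j\<le>h + h'. P j \<tau> * x ^ j)"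
      unfolding P_def by (rule polynomial_product) (auto simp: K_def K'_def)
    finally show "f (moebius (a, b, c, d) \<tau>) * f' (moebius (a, b, c, d) \<tau>) =
      chi d * chi' d * (of_int c * \<tau> + of_int d) powi (w + w') *
        (\<Sum>j\<le>h + h'. P j \<tau> * (of_int c / (of_int c * \<tau> + of_int d)) ^ j)"
      by (simp add: l_def x_def)
  next
    fix r a b c d assume S: "(a, b, c, d) \<in> SL2Z"
    define l where "l \<tau> = of_int c * \<tau> + of_int d" for \<tau> :: complex
    have "Bfun (\<lambda>\<tau>. \<Sum>k\<le>r. (l \<tau> powi (- (w - 2 * int k)) * K k (moebius (a, b, c, d) \<tau>)) *
        (l \<tau> powi (- (w' - 2 * int (r - k))) * K' (r - k) (moebius (a, b, c, d) \<tau>)))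
        (filtercomap Im at_top)"
      unfolding l_def by (intro Bfun_sum Bfun_times K_bound K'_bound S)
    moreover have "\<forall>\<^sub>F \<tau> in filtercomap Im at_top.
      (\<Sum>k\<le>r. (l \<tau> powi (- (w - 2 * int k)) * K k (moebius (a, b, c, d) \<tau>)) *
        (l \<tau> powi (- (w' - 2 * int (r - k))) * K' (r - k) (moebius (a, b, c, d) \<tau>))) =
      l \<tau> powi (- (w + w' - 2 * int r)) * P r (moebius (a, b, c, d) \<tau>)"
      using eventually_Im_ge[of 1]
    proof eventually_elim
      case (elim \<tau>)
      have l: "l \<tau> \<noteq> 0" unfolding l_def
        using S elim by (intro automorphy_factor_nonzero[of a b]) auto
      have "l \<tau> powi (- (w - 2 * int k)) * l \<tau> powi (- (w' - 2 * int (r - k))) =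
          l \<tau> powi (- (w + w' - 2 * int r))" if "k \<le> r" for k
        using l that by (subst power_int_add[symmetric]) (simp_all add: of_nat_diff algebra_simps)
      thus ?case
        unfolding P_def sum_distrib_left by (intro sum.cong refl) (simp add: mult_ac)
    qed
    ultimately show "Bfun (\<lambda>\<tau>. (of_int c * \<tau> + of_int d) powi (- (w + w' - 2 * int r)) *
        P r (moebius (a, b, c, d) \<tau>)) (filtercomap Im at_top)"
      unfolding l_def by (rule Bfun_cong_ev[rotated])
  qed
qed

lemma quasimodular_form_mult:
  assumes "quasimodular_form w N f" "quasimodular_form w' N f'"
  shows "quasimodular_form (w + w') N (\<lambda>\<tau>. f \<tau> * f' \<tau>)"
proof (cases "(\<forall>\<tau>\<in>\<H>. f \<tau> = 0) \<or> (\<forall>\<tau>\<in>\<H>. f' \<tau> = 0)")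
  case True
  thus ?thesis by (auto simp: quasimodular_form_def)
next
  case False
  then obtain h chi h' chi' where "dirichlet_character N chi" "quasimodular_of w h chi N f"
    "dirichlet_character N chi'" "quasimodular_of w' h' chi' N f'"
    using assms by (auto simp: quasimodular_form_def)
  hence "dirichlet_character N (\<lambda>d. chi d * chi' d)"
    "quasimodular_of (w + w') (h + h') (\<lambda>d. chi d * chi' d) N (\<lambda>\<tau>. f \<tau> * f' \<tau>)"
    by (simp_all add: quasimodular_of_mult dirichlet_character_mult)
  thus ?thesis unfolding quasimodular_form_def by blast
qed

lemma quasimodular_lincomb_cong:
  assumes "quasimodular_lincomb k N F" "\<And>\<tau>. \<tau> \<in> \<H> \<Longrightarrow> F \<tau> = F' \<tau>"
  shows "quasimodular_lincomb k N F'"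
  using assms unfolding quasimodular_lincomb_def by metis

lemma quasimodular_lincomb_form:
  assumes "quasimodular_form w N f" "w \<le> k"
  shows "quasimodular_lincomb k N f"
  unfolding quasimodular_lincomb_def
  by (rule exI[of _ 1], rule exI[of _ "\<lambda>_. 1"], rule exI[of _ "\<lambda>_. f"], rule exI[of _ "\<lambda>_. w"])
     (use assms in auto)

lemma quasimodular_lincomb_zero: "quasimodular_lincomb k N (\<lambda>_. 0)"
  unfolding quasimodular_lincomb_def by (rule exI[of _ 0]) auto

lemma quasimodular_lincomb_scale:
  assumes "quasimodular_lincomb k N F"
  shows "quasimodular_lincomb k N (\<lambda>\<tau>. x * F \<tau>)"
proof -
  obtain m :: nat and \<alpha> f w where *: "\<And>i. i < m \<Longrightarrow> w i \<le> k \<and> quasimodular_form (w i) N (f i)"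
    "\<And>\<tau>. \<tau> \<in> \<H> \<Longrightarrow> F \<tau> = (\<Sum>i<m. \<alpha> i * f i \<tau>)"
    using assms unfolding quasimodular_lincomb_def by blast
  show ?thesis
    unfolding quasimodular_lincomb_def
    by (rule exI[of _ m], rule exI[of _ "\<lambda>i. x * \<alpha> i"], rule exI[of _ f], rule exI[of _ w])
       (use * in \<open>auto simp: sum_distrib_left mult.assoc\<close>)
qed

lemma quasimodular_lincomb_add:
  assumes "quasimodular_lincomb k N F" "quasimodular_lincomb k N F'"
  shows "quasimodular_lincomb k N (\<lambda>\<tau>. F \<tau> + F' \<tau>)"
proof -
  obtain m :: nat and \<alpha> f w where *: "\<And>i. i < m \<Longrightarrow> w i \<le> k \<and> quasimodular_form (w i) N (f i)"
    "\<And>\<tau>. \<tau> \<in> \<H> \<Longrightarrow> F \<tau> = (\<Sum>i<m. \<alpha> i * f i \<tau>)"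
    using assms(1) unfolding quasimodular_lincomb_def by blast
  obtain m' :: nat and \<alpha>' f' w' where **: "\<And>i. i < m' \<Longrightarrow> w' i \<le> k \<and> quasimodular_form (w' i) N (f' i)"
    "\<And>\<tau>. \<tau> \<in> \<H> \<Longrightarrow> F' \<tau> = (\<Sum>i<m'. \<alpha>' i * f' i \<tau>)"
    using assms(2) unfolding quasimodular_lincomb_def by blast
  have split: "(\<Sum>i<m + m'. h i) = (\<Sum>i<m. h i) + (\<Sum>i<m'. h (m + i))" for h :: "nat \<Rightarrow> complex"
    by (induction m') (auto simp: add.assoc)
  show ?thesis
    unfolding quasimodular_lincomb_def
    by (rule exI[of _ "m + m'"], rule exI[of _ "\<lambda>i. if i < m then \<alpha> i else \<alpha>' (i - m)"],
        rule exI[of _ "\<lambda>i. if i < m then f i else f' (i - m)"],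
        rule exI[of _ "\<lambda>i. if i < m then w i else w' (i - m)"])
       (use * ** in \<open>auto simp: split\<close>)
qed

lemma quasimodular_lincomb_sum:
  assumes "\<And>i. i \<in> I \<Longrightarrow> quasimodular_lincomb k N (F i)"
  shows "quasimodular_lincomb k N (\<lambda>\<tau>. \<Sum>i\<in>I. F i \<tau>)"
  using assms
  by (induction I rule: infinite_finite_induct)
     (simp_all add: quasimodular_lincomb_add quasimodular_lincomb_zero)

lemma quasimodular_lincomb_mult:
  assumes "quasimodular_lincomb k N F" "quasimodular_lincomb k' N F'"
  shows "quasimodular_lincomb (k + k') N (\<lambda>\<tau>. F \<tau> * F' \<tau>)"
proof -
  obtain m :: nat and \<alpha> f w where *: "\<And>i. i < m \<Longrightarrow> w i \<le> k \<and> quasimodular_form (w i) N (f i)"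
    "\<And>\<tau>. \<tau> \<in> \<H> \<Longrightarrow> F \<tau> = (\<Sum>i<m. \<alpha> i * f i \<tau>)"
    using assms(1) unfolding quasimodular_lincomb_def by blast
  obtain m' :: nat and \<alpha>' f' w' where **: "\<And>i. i < m' \<Longrightarrow> w' i \<le> k' \<and> quasimodular_form (w' i) N (f' i)"
    "\<And>\<tau>. \<tau> \<in> \<H> \<Longrightarrow> F' \<tau> = (\<Sum>i<m'. \<alpha>' i * f' i \<tau>)"
    using assms(2) unfolding quasimodular_lincomb_def by blast
  have "quasimodular_lincomb (k + k') N (\<lambda>\<tau>. f i \<tau> * f' j \<tau>)" if "i < m" "j < m'" for i j
    using *(1)[OF that(1)] **(1)[OF that(2)]
    by (intro quasimodular_lincomb_form[of "w i + w' j"] quasimodular_form_mult) auto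
  hence "quasimodular_lincomb (k + k') N
      (\<lambda>\<tau>. \<Sum>i<m. \<Sum>j<m'. (\<alpha> i * \<alpha>' j) * (f i \<tau> * f' j \<tau>))"
    by (intro quasimodular_lincomb_sum quasimodular_lincomb_scale) auto
  thus ?thesis
    by (rule quasimodular_lincomb_cong) (simp only: *(2) **(2) sum_product, simp add: mult_ac)
qed

lemma quasimodular_lincomb_mono:
  assumes "quasimodular_lincomb k N F" "k \<le> k'"
  shows "quasimodular_lincomb k' N F"
proof -
  obtain m :: nat and \<alpha> f w where *: "\<And>i. i < m \<Longrightarrow> w i \<le> k \<and> quasimodular_form (w i) N (f i)"
    "\<And>\<tau>. \<tau> \<in> \<H> \<Longrightarrow> F \<tau> = (\<Sum>i<m. \<alpha> i * f i \<tau>)"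
    using assms(1) unfolding quasimodular_lincomb_def by blast
  have "w i \<le> k'" if "i < m" for i
    using *(1)[OF that] assms(2) by simp
  thus ?thesis
    unfolding quasimodular_lincomb_def
    by (rule_tac exI[of _ m], rule_tac exI[of _ \<alpha>], rule_tac exI[of _ f], rule_tac exI[of _ w])
       (use * in auto)
qed

section \<open>Power sums of the summands\<close>

definition e2pi :: "complex \<Rightarrow> complex" where
  "e2pi z = exp (2 * of_real pi * \<i> * z)"

text \<open>
  The terms \<open>x\<^sub>n\<close>, with the parameter \<open>z\<close> in place of \<open>a = -2 cos (2 \<pi> z)\<close>: the zeros of
  \<open>1 + a x + x\<^sup>2\<close> are then \<open>exp (2 \<pi> \<i> z)\<close> and its inverse.
\<close>

definition summand :: "complex \<Rightarrow> complex \<Rightarrow> nat \<Rightarrow> complex" where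
  "summand z q n = q ^ n / (1 - 2 * cos (2 * of_real pi * z) * q ^ n + q ^ (2 * n))"

definition power_sum :: "complex \<Rightarrow> complex \<Rightarrow> nat \<Rightarrow> complex" where
  "power_sum z q k = (\<Sum>n. summand z q (Suc n) ^ k)"

text \<open>
  The derivative of \<open>-2 cos (2 \<pi> z)\<close>, and the factor by which sums of cotangents differ from the
  terms \<open>x\<^sub>n\<close>.
\<close>

definition four_pi_sin :: "complex \<Rightarrow> complex" where
  "four_pi_sin z = 4 * of_real pi * sin (2 * of_real pi * z)"

text \<open>
  For \<open>q = exp (2 \<pi> \<i> \<tau>)\<close> this says \<open>\<bar>Im z\<bar> < Im \<tau>\<close>, a region in which no denominator vanishes. Stated in
  terms of \<open>q\<close> it is open in both variables, which is what termwise differentiation needs.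
\<close>

definition in_strip :: "complex \<Rightarrow> complex \<Rightarrow> bool" where
  "in_strip z q \<longleftrightarrow> norm (e2pi z) * norm q < 1 \<and> norm (e2pi (-z)) * norm q < 1"

lemma e2pi_nonzero [simp]: "e2pi z \<noteq> 0"
  by (simp add: e2pi_def)

lemma e2pi_add: "e2pi (z + w) = e2pi z * e2pi w"
  by (simp only: e2pi_def distrib_left exp_add)

lemma e2pi_minus: "e2pi (-z) = inverse (e2pi z)"
  by (simp add: e2pi_def exp_minus)

lemma e2pi_diff: "e2pi (z - w) = e2pi z / e2pi w"
  using e2pi_add[of z "-w"] by (simp add: e2pi_minus field_simps)

lemma e2pi_of_nat_mult: "e2pi (of_nat n * z) = e2pi z ^ n"
  by (simp add: e2pi_def exp_of_nat_mult[symmetric] mult_ac)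

lemma e2pi_of_int [simp]: "e2pi (of_int n) = 1"
  unfolding e2pi_def exp_eq_1 by (auto intro!: exI[of _ n])

lemma norm_e2pi: "norm (e2pi z) = exp (-(2 * pi * Im z))"
  by (simp add: e2pi_def norm_exp_eq_Re)

lemma norm_e2pi_less_1: "Im \<tau> > 0 \<Longrightarrow> norm (e2pi \<tau>) < 1"
  by (simp add: norm_e2pi)

lemma cos_2pi_eq: "2 * cos (2 * of_real pi * z) = e2pi z + e2pi (-z)"
  by (simp add: cos_exp_eq e2pi_def mult_ac)

lemma four_pi_sin_eq: "four_pi_sin z = -2 * of_real pi * \<i> * (e2pi z - e2pi (-z))"
  by (simp add: four_pi_sin_def sin_exp_eq e2pi_def field_simps)

lemma summand_denominator:
  "1 - 2 * cos (2 * of_real pi * z) * q ^ n + q ^ (2 * n) = (1 - e2pi z * q ^ n) * (1 - e2pi (-z) * q ^ n)"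
proof -
  have *: "e2pi z * e2pi (-z) = 1" by (simp add: e2pi_minus)
  have "(1 - e2pi z * q ^ n) * (1 - e2pi (-z) * q ^ n) =
      1 - (e2pi z + e2pi (-z)) * q ^ n + (e2pi z * e2pi (-z)) * (q ^ n * q ^ n)"
    by (simp add: algebra_simps)
  also have "\<dots> = 1 - 2 * cos (2 * of_real pi * z) * q ^ n + q ^ (2 * n)"
    by (simp only: * cos_2pi_eq mult_2[of n] power_add mult_1)
  finally show ?thesis ..
qed

lemma continuous_on_e2pi [continuous_intros]:
  "continuous_on A f \<Longrightarrow> continuous_on A (\<lambda>z. e2pi (f z))"
  unfolding e2pi_def by (intro continuous_intros)

lemma in_strip_iff: "in_strip z (e2pi \<tau>) \<longleftrightarrow> \<bar>Im z\<bar> < Im \<tau>"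
proof -
  have "norm (e2pi z) * norm (e2pi \<tau>) = exp (- (2 * pi) * (Im z + Im \<tau>))"
    "norm (e2pi (-z)) * norm (e2pi \<tau>) = exp (- (2 * pi) * (Im \<tau> - Im z))"
    by (simp_all add: norm_e2pi ring_distribs flip: exp_add)
  hence "in_strip z (e2pi \<tau>) \<longleftrightarrow> 0 < Im z + Im \<tau> \<and> 0 < Im \<tau> - Im z"
    by (simp add: in_strip_def zero_less_mult_iff)
  thus ?thesis by auto
qed

lemma norm_summand_le:
  assumes "norm (e2pi z * q ^ n) \<le> r" "norm (e2pi (-z) * q ^ n) \<le> r" "r < 1"
  shows "norm (summand z q n) \<le> norm q ^ n / (1 - r)\<^sup>2"
proof -
  have *: "1 - r \<le> norm (1 - e2pi z * q ^ n)" "1 - r \<le> norm (1 - e2pi (-z) * q ^ n)"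
    using assms norm_triangle_ineq2[of 1 "e2pi z * q ^ n"] norm_triangle_ineq2[of 1 "e2pi (-z) * q ^ n"]
    by auto
  hence "(1 - r)\<^sup>2 \<le> norm (1 - e2pi z * q ^ n) * norm (1 - e2pi (-z) * q ^ n)"
    unfolding power2_eq_square using assms by (intro mult_mono) auto
  thus ?thesis
    unfolding summand_def summand_denominator norm_divide norm_mult norm_power
    using assms(3) by (intro divide_left_mono) (auto intro!: mult_pos_pos)
qed

text \<open>
  The two exponential factors are inverse to each other, so the product of the left-hand sides of the
  first two hypotheses is \<open>\<bar>q\<bar>\<^sup>2\<close>.
\<close>

lemma in_strip_bound:
  assumes "norm (e2pi z) * norm q \<le> r" "norm (e2pi (-z)) * norm q \<le> r" "r < 1" "n > 0"
  shows "norm q \<le> r" "norm (e2pi z * q ^ n) \<le> r" "norm (e2pi (-z) * q ^ n) \<le> r"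
proof -
  have r: "r \<ge> 0" using assms(1) by (meson mult_nonneg_nonneg norm_ge_zero order_trans)
  have "norm q ^ 2 = (norm (e2pi z) * norm q) * (norm (e2pi (-z)) * norm q)"
    by (simp add: e2pi_minus norm_inverse power2_eq_square)
  also have "\<dots> \<le> r ^ 2"
    unfolding power2_eq_square using assms r by (intro mult_mono) auto
  finally show q: "norm q \<le> r" using r by (simp add: power2_le_iff_abs_le)
  obtain m where m: "n = Suc m" using assms(4) by (cases n) auto
  have *: "norm q ^ m \<le> 1" using q assms(3) by (intro power_le_one) auto
  have "norm (e2pi z * q ^ n) = (norm (e2pi z) * norm q) * norm q ^ m"
    by (simp add: m norm_mult norm_power)
  also have "\<dots> \<le> r * 1" using assms * r by (intro mult_mono) auto
  finally show "norm (e2pi z * q ^ n) \<le> r" by simp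
  have "norm (e2pi (-z) * q ^ n) = (norm (e2pi (-z)) * norm q) * norm q ^ m"
    by (simp add: m norm_mult norm_power)
  also have "\<dots> \<le> r * 1" using assms * r by (intro mult_mono) auto
  finally show "norm (e2pi (-z) * q ^ n) \<le> r" by simp
qed

lemma summand_denominator_nonzero:
  assumes "in_strip z q" "n > 0"
  shows "1 - 2 * cos (2 * of_real pi * z) * q ^ n + q ^ (2 * n) \<noteq> 0"
proof -
  define r where "r = max (norm (e2pi z) * norm q) (norm (e2pi (-z)) * norm q)"
  have r: "r < 1" "norm (e2pi z) * norm q \<le> r" "norm (e2pi (-z)) * norm q \<le> r"
    using assms by (auto simp: r_def in_strip_def)
  from in_strip_bound[OF r(2,3,1) assms(2)] r(1)
  have "e2pi z * q ^ n \<noteq> 1" "e2pi (-z) * q ^ n \<noteq> 1" by auto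
  thus ?thesis unfolding summand_denominator by simp
qed

lemma norm_summand_power_le:
  assumes "norm (e2pi z) * norm q \<le> r" "norm (e2pi (-z)) * norm q \<le> r" "r < 1" "k > 0"
  shows "norm (summand z q (Suc n) ^ k) \<le> r ^ Suc n * (1 / (1 - r)\<^sup>2) ^ k"
proof -
  note * = in_strip_bound[OF assms(1-3) zero_less_Suc[of n]]
  have r: "0 \<le> r" using assms(1) by (meson mult_nonneg_nonneg norm_ge_zero order_trans)
  have "norm (summand z q (Suc n) ^ k) \<le> (norm q ^ Suc n * (1 / (1 - r)\<^sup>2)) ^ k"
    unfolding norm_power using norm_summand_le[OF *(2,3) assms(3)] by (intro power_mono) auto
  also have "\<dots> \<le> (r ^ Suc n * (1 / (1 - r)\<^sup>2)) ^ k"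
    using *(1) by (intro power_mono mult_right_mono) auto
  also have "\<dots> = (r ^ Suc n) ^ k * (1 / (1 - r)\<^sup>2) ^ k"
    by (rule power_mult_distrib)
  also have "\<dots> \<le> (r ^ Suc n) ^ 1 * (1 / (1 - r)\<^sup>2) ^ k"
    using r assms(3,4) by (intro mult_right_mono power_decreasing) (auto intro!: power_le_one simp del: power_Suc)
  finally show ?thesis by simp
qed

lemma open_strip: "open {z. in_strip z q}" "open {q. in_strip z q}"
  unfolding in_strip_def by (intro open_Collect_conj open_Collect_less continuous_intros)+

text \<open>
  One majorant that works near \<open>z\<close> for fixed \<open>q\<close> and near \<open>q\<close> for fixed \<open>z\<close>: the power sums are
  differentiated in \<open>z\<close>, and their holomorphy in \<open>\<tau>\<close> comes from that in \<open>q\<close>.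
\<close>

lemma local_summable_bound:
  assumes "in_strip z q" "k > 0"
  shows "\<exists>d (h :: nat \<Rightarrow> complex). 0 < d \<and> summable h \<and> range h \<subseteq> \<real>\<^sub>\<ge>\<^sub>0 \<and>
           (\<forall>n. \<forall>w\<in>ball z d. norm (summand w q (Suc n) ^ k) \<le> norm (h n)) \<and>
           (\<forall>n. \<forall>p\<in>ball q d. norm (summand z p (Suc n) ^ k) \<le> norm (h n))"
proof -
  define r0 where "r0 = max (norm (e2pi z) * norm q) (norm (e2pi (-z)) * norm q)"
  have "r0 < 1" using assms by (auto simp: r0_def in_strip_def)
  then obtain r where r: "r0 < r" "r < 1" using dense by blast
  have "0 \<le> norm (e2pi z) * norm q" by simp
  also have "\<dots> \<le> r0" by (simp add: r0_def)
  finally have "r > 0" using r by simp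
  have *: "norm (e2pi z) * norm q < r" "norm (e2pi (-z)) * norm q < r" using r by (auto simp: r0_def)
  have "open {w. norm (e2pi w) * norm q < r \<and> norm (e2pi (-w)) * norm q < r}"
    by (intro open_Collect_conj open_Collect_less continuous_intros)
  then obtain d1 where d1: "d1 > 0"
    "ball z d1 \<subseteq> {w. norm (e2pi w) * norm q < r \<and> norm (e2pi (-w)) * norm q < r}"
    using * by (auto elim!: openE)
  have "open {p. norm (e2pi z) * norm p < r \<and> norm (e2pi (-z)) * norm p < r}"
    by (intro open_Collect_conj open_Collect_less continuous_intros)
  then obtain d2 where d2: "d2 > 0"
    "ball q d2 \<subseteq> {p. norm (e2pi z) * norm p < r \<and> norm (e2pi (-z)) * norm p < r}"
    using * by (auto elim!: openE)
  define h :: "nat \<Rightarrow> complex" where "h n = of_real (r ^ Suc n * (1 / (1 - r)\<^sup>2) ^ k)" for n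
  have norm_h: "norm (h n) = r ^ Suc n * (1 / (1 - r)\<^sup>2) ^ k" for n
    unfolding h_def norm_of_real using \<open>r > 0\<close> by (intro abs_of_nonneg) auto
  show ?thesis
  proof (intro exI[of _ "min d1 d2"] exI[of _ h] conjI allI ballI)
    show "min d1 d2 > 0" using d1 d2 by simp
    show "summable h" unfolding h_def summable_of_real_iff power_Suc
      using r \<open>r > 0\<close> by (intro summable_mult2 summable_mult summable_geometric) auto
    show "range h \<subseteq> \<real>\<^sub>\<ge>\<^sub>0"
      using \<open>r > 0\<close> by (auto simp: h_def simp del: of_real_mult of_real_power)
    show "norm (summand w q (Suc n) ^ k) \<le> norm (h n)" if "w \<in> ball z (min d1 d2)" for n w
    proof -
      have "w \<in> ball z d1" using that by simp
      thus ?thesis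
        unfolding norm_h using d1(2) r(2) assms(2) by (intro norm_summand_power_le) auto
    qed
    show "norm (summand z p (Suc n) ^ k) \<le> norm (h n)" if "p \<in> ball q (min d1 d2)" for n p
    proof -
      have "p \<in> ball q d2" using that by simp
      thus ?thesis
        unfolding norm_h using d2(2) r(2) assms(2) by (intro norm_summand_power_le) auto
    qed
  qed
qed

lemma summable_norm_summand:
  assumes "in_strip z q" "k > 0"
  shows "summable (\<lambda>n. norm (summand z q (Suc n) ^ k))"
proof -
  obtain d and h :: "nat \<Rightarrow> complex" where "d > 0" "summable h" "range h \<subseteq> \<real>\<^sub>\<ge>\<^sub>0"
    and h: "\<forall>n. \<forall>w\<in>ball z d. norm (summand w q (Suc n) ^ k) \<le> norm (h n)"
    using local_summable_bound[OF assms] by blast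
  have "norm (h n) = Re (h n)" for n
    using \<open>range h \<subseteq> \<real>\<^sub>\<ge>\<^sub>0\<close> nonneg_Reals_cmod_eq_Re by blast
  hence "summable (\<lambda>n. norm (h n))"
    using summable_Re[OF \<open>summable h\<close>] by simp
  thus ?thesis
  proof (rule summable_comparison_test'[where N = 0])
    fix n
    show "norm (norm (summand z q (Suc n) ^ k)) \<le> norm (h n)"
      using h[rule_format, of z n] \<open>d > 0\<close> by simp
  qed
qed

lemma has_field_derivative_summand_power:
  assumes "in_strip z q" "k > 0" "n > 0"
  shows "((\<lambda>z. summand z q n ^ k) has_field_derivative
           - of_nat k * four_pi_sin z * summand z q n ^ Suc k) (at z)"
proof -
  define D where "D z = 1 - 2 * cos (2 * of_real pi * z) * q ^ n + q ^ (2 * n)" for z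
  have D: "D z \<noteq> 0" unfolding D_def using assms(1,3) by (rule summand_denominator_nonzero)
  have "((\<lambda>z. cos (2 * of_real pi * z)) has_field_derivative
      - sin (2 * of_real pi * z) * (2 * of_real pi * 1)) (at z)"
    by (intro DERIV_fun_cos DERIV_cmult DERIV_ident)
  from DERIV_add[OF DERIV_diff[OF DERIV_const DERIV_cmult_right[OF DERIV_cmult[OF this]]] DERIV_const]
  have "(D has_field_derivative four_pi_sin z * q ^ n) (at z)"
    unfolding D_def[abs_def] four_pi_sin_def by (rule DERIV_cong) (simp add: algebra_simps)
  from DERIV_cmult[OF DERIV_inverse_fun[OF this D], of "q ^ n"]
  have "((\<lambda>z. summand z q n) has_field_derivative - (four_pi_sin z * summand z q n ^ 2)) (at z)"
    unfolding summand_def D_def[symmetric] divide_inverse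
    by (rule DERIV_cong) (simp add: power2_eq_square field_simps)
  from DERIV_power[OF this, of k] show ?thesis
    using assms(2) by (cases k) (simp_all add: power2_eq_square algebra_simps)
qed

lemma power_sum_sums:
  assumes "in_strip z q" "k > 0"
  shows "(\<lambda>n. summand z q (Suc n) ^ k) sums power_sum z q k"
  unfolding power_sum_def
  using summable_norm_cancel[OF summable_norm_summand[OF assms]] by (rule summable_sums)

text \<open>
  Differentiation in \<open>z\<close> raises the exponent, because \<open>x\<^sub>n\<close> has the derivative \<open>-x\<^sub>n\<^sup>2\<close> with respect
  to \<open>a\<close>.
\<close>

lemma has_field_derivative_power_sum:
  assumes "in_strip z q" "k > 0"
  shows "((\<lambda>z. power_sum z q k) has_field_derivative
           - of_nat k * four_pi_sin z * power_sum z q (Suc k)) (at z)"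
proof -
  let ?S = "{z. in_strip z q}"
  have "\<exists>g g'. \<forall>z\<in>?S. ((\<lambda>n. summand z q (Suc n) ^ k) sums g z) \<and>
      ((\<lambda>n. - of_nat k * four_pi_sin z * summand z q (Suc n) ^ Suc k) sums g' z) \<and>
      (g has_field_derivative g' z) (at z)"
  proof (rule series_and_derivative_comparison_complex[OF open_strip(1)])
    fix z assume "z \<in> ?S"
    hence "in_strip z q" by simp
    obtain d and h :: "nat \<Rightarrow> complex" where "d > 0" "summable h" "range h \<subseteq> \<real>\<^sub>\<ge>\<^sub>0"
      "\<forall>n. \<forall>w\<in>ball z d. norm (summand w q (Suc n) ^ k) \<le> norm (h n)"
      using local_summable_bound[OF \<open>in_strip z q\<close> assms(2)] by blast
    thus "\<exists>d (h :: nat \<Rightarrow> complex). 0 < d \<and> summable h \<and> range h \<subseteq> \<real>\<^sub>\<ge>\<^sub>0 \<and>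
        (\<forall>\<^sub>F n in sequentially. \<forall>y\<in>ball z d \<inter> ?S. norm (summand y q (Suc n) ^ k) \<le> norm (h n))"
      by (intro exI[of _ d] exI[of _ h]) auto
  next
    fix n z assume "z \<in> ?S"
    thus "((\<lambda>z. summand z q (Suc n) ^ k) has_field_derivative
        - of_nat k * four_pi_sin z * summand z q (Suc n) ^ Suc k) (at z)"
      using assms by (intro has_field_derivative_summand_power) auto
  qed
  then obtain g g' where g: "\<And>z. in_strip z q \<Longrightarrow> (\<lambda>n. summand z q (Suc n) ^ k) sums g z"
    "\<And>z. in_strip z q \<Longrightarrow> (\<lambda>n. - of_nat k * four_pi_sin z * summand z q (Suc n) ^ Suc k) sums g' z"
    "\<And>z. in_strip z q \<Longrightarrow> (g has_field_derivative g' z) (at z)"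
    by (auto simp del: power_Suc)
  have g_eq: "g w = power_sum w q k" if "in_strip w q" for w
    using sums_unique2[OF g(1)[OF that] power_sum_sums[OF that assms(2)]] .
  have "g' z = - of_nat k * four_pi_sin z * power_sum z q (Suc k)"
    using sums_unique2[OF g(2)[OF assms(1)] sums_mult[OF power_sum_sums[OF assms(1) zero_less_Suc]]] .
  with g(3)[OF assms(1)] show ?thesis
    using has_field_derivative_transform_within_open[OF _ open_strip(1), of g _ z q] g_eq assms(1)
    by simp
qed

lemma holomorphic_power_sum:
  assumes "k > 0"
  shows "(\<lambda>q. power_sum z q k) holomorphic_on {q. in_strip z q}"
proof -
  let ?S = "{q. in_strip z q}"
  have "\<exists>g. \<forall>q\<in>?S. ((\<lambda>n. summand z q (Suc n) ^ k) sums g q) \<and> g field_differentiable (at q)"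
  proof (rule series_differentiable_comparison_complex[OF open_strip(2)])
    fix q n assume "q \<in> ?S"
    have "(\<lambda>q. summand z q (Suc n) ^ k) holomorphic_on ?S"
      unfolding summand_def using summand_denominator_nonzero[OF _ zero_less_Suc]
      by (intro holomorphic_intros) simp_all
    thus "(\<lambda>q. summand z q (Suc n) ^ k) field_differentiable at q"
      using open_strip(2) \<open>q \<in> ?S\<close> by (rule holomorphic_on_imp_differentiable_at)
  next
    fix q assume "q \<in> ?S"
    hence "in_strip z q" by simp
    obtain d and h :: "nat \<Rightarrow> complex" where "d > 0" "summable h" "range h \<subseteq> \<real>\<^sub>\<ge>\<^sub>0"
      "\<forall>n. \<forall>w\<in>ball q d. norm (summand z w (Suc n) ^ k) \<le> norm (h n)"
      using local_summable_bound[OF \<open>in_strip z q\<close> assms] by blast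
    thus "\<exists>d (h :: nat \<Rightarrow> complex). 0 < d \<and> summable h \<and> range h \<subseteq> \<real>\<^sub>\<ge>\<^sub>0 \<and>
        (\<forall>\<^sub>F n in sequentially. \<forall>y\<in>ball q d \<inter> ?S. norm (summand z y (Suc n) ^ k) \<le> norm (h n))"
      by (intro exI[of _ d] exI[of _ h]) auto
  qed (rule exI)
  then obtain g where g: "\<And>q. q \<in> ?S \<Longrightarrow> (\<lambda>n. summand z q (Suc n) ^ k) sums g q"
    "\<And>q. q \<in> ?S \<Longrightarrow> g field_differentiable (at q)" by blast
  have "g holomorphic_on ?S"
    using g(2) by (rule holomorphic_onI[OF field_differentiable_at_within])
  moreover have "g q = power_sum z q k" if "q \<in> ?S" for q
    using sums_unique2[OF g(1)[OF that] power_sum_sums] that assms by simp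
  ultimately show ?thesis by (rule holomorphic_transform)
qed

section \<open>Eisenstein's quasi-elliptic function\<close>

text \<open>
  At an integer the value is \<open>0\<close>, as division by zero gives \<open>0\<close>. With this value the function is odd
  and periodic everywhere, so that the shift formulas below hold at the poles, too.
\<close>

definition pi_cot :: "complex \<Rightarrow> complex" where
  "pi_cot z = of_real pi * cot (of_real pi * z)"

lemma pi_cot_eq: "pi_cot z = of_real pi * \<i> * (e2pi z + 1) / (e2pi z - 1)"
proof -
  define E where "E = exp (\<i> * (of_real pi * z))"
  have E: "E \<noteq> 0" by (simp add: E_def)
  have q: "e2pi z = E * E"
    unfolding E_def e2pi_def exp_add[symmetric]
    by (rule arg_cong[of _ _ exp]) (simp add: algebra_simps)
  have E': "exp (- (\<i> * (of_real pi * z))) = 1 / E"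
    by (simp add: E_def exp_minus field_simps)
  have c: "cos (of_real pi * z) = (E * E + 1) / (2 * E)"
    unfolding cos_exp_eq E' E_def[symmetric] using E by (simp add: field_simps)
  have s: "sin (of_real pi * z) = (E * E - 1) / (2 * \<i> * E)"
    unfolding sin_exp_eq E' E_def[symmetric] using E by (simp add: field_simps)
  show ?thesis
  proof (cases "E * E = 1")
    case True
    thus ?thesis by (simp add: pi_cot_def cot_def s q)
  next
    case False
    hence "E * E - 1 \<noteq> 0" by simp
    thus ?thesis using E unfolding pi_cot_def cot_def s q c by (simp add: field_simps)
  qed
qed

lemma pi_cot_minus [simp]: "pi_cot (-z) = - pi_cot z"
  by (simp add: pi_cot_def)

lemma pi_cot_add_of_int [simp]: "pi_cot (z + of_int n) = pi_cot z"
  by (simp add: pi_cot_eq e2pi_add)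

text \<open>
  A partial fraction decomposition in \<open>w = exp (2 \<pi> \<i> z)\<close> and \<open>x = q\<^sup>n\<close>. It links the elliptic side to the
  terms \<open>x\<^sub>n\<close>.
\<close>

lemma pi_cot_add_pi_cot_diff:
  assumes "e2pi z * q ^ n \<noteq> 1" "e2pi (-z) * q ^ n \<noteq> 1" "q = e2pi \<tau>"
  shows "pi_cot (z + of_nat n * \<tau>) + pi_cot (z - of_nat n * \<tau>) = four_pi_sin z * summand z q n"
proof -
  define w x where "w = e2pi z" and "x = q ^ n"
  have wx: "e2pi (z + of_nat n * \<tau>) = w * x" "e2pi (z - of_nat n * \<tau>) = w / x" "e2pi (-z) = 1 / w"
    by (simp_all add: e2pi_add e2pi_diff e2pi_of_nat_mult e2pi_minus w_def x_def assms(3) inverse_eq_divide)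
  have nz: "w \<noteq> 0" "x \<noteq> 0" "w * x - 1 \<noteq> 0" "w - x \<noteq> 0" "1 - w * x \<noteq> 0"
    using assms by (auto simp: w_def x_def e2pi_minus field_simps)
  have pi_cot_quot: "pi_cot u = of_real pi * \<i> * ((e2pi u + 1) / (e2pi u - 1))" for u
    by (simp add: pi_cot_eq)
  have "(w / x + 1) / (w / x - 1) = (w + x) / (w - x)"
    using nz by (simp add: field_simps)
  hence "pi_cot (z + of_nat n * \<tau>) + pi_cot (z - of_nat n * \<tau>) =
     of_real pi * \<i> * ((w * x + 1) / (w * x - 1) + (w + x) / (w - x))"
    by (simp only: pi_cot_quot wx distrib_left)
  moreover have "(w * x + 1) / (w * x - 1) + (w + x) / (w - x) =
      2 * x * (w * w - 1) / ((w * x - 1) * (w - x))"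
    using nz by (simp add: add_frac_eq) (simp add: algebra_simps)
  moreover have "four_pi_sin z * summand z q n =
      (-2 * of_real pi * \<i> * (w - 1 / w)) * (x / ((1 - w * x) * (1 - 1 / w * x)))"
    unfolding summand_def summand_denominator four_pi_sin_eq wx by (simp only: w_def x_def)
  moreover have "w - 1 / w = (w * w - 1) / w" "1 - 1 / w * x = (w - x) / w"
    using nz by (simp_all add: field_simps)
  moreover have "of_real pi * \<i> * (2 * x * (w * w - 1) / ((w * x - 1) * (w - x))) =
      (-2 * of_real pi * \<i> * ((w * w - 1) / w)) * (x / ((1 - w * x) * ((w - x) / w)))"
    using nz by (simp add: divide_simps) (simp add: algebra_simps)
  ultimately show ?thesis by (simp only:)
qed

text \<open>
  Eisenstein's series \<open>E\<^sub>1\<close>; in Weierstrass's notation it is \<open>\<zeta>(z) - \<eta>\<^sub>1 z\<close>, where \<open>\<eta>\<^sub>1\<close> is the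
  quasi-period that belongs to the period \<open>1\<close>. At lattice points one summand has the default value
  \<open>0\<close>, so the function is odd without exception and vanishes at \<open>0\<close>.
\<close>

definition Eis1 :: "complex \<Rightarrow> complex \<Rightarrow> complex" where
  "Eis1 \<tau> z = pi_cot z +
     (\<Sum>n. pi_cot (z + of_nat (Suc n) * \<tau>) + pi_cot (z - of_nat (Suc n) * \<tau>))"

text \<open>
  Only finitely many terms can have a pole, and the others are small by the partial fraction identity.
\<close>

lemma summable_Eis1:
  assumes "Im \<tau> > 0"
  shows "summable (\<lambda>n. pi_cot (z + of_nat (Suc n) * \<tau>) + pi_cot (z - of_nat (Suc n) * \<tau>))"
proof (rule summable_comparison_test_ev)
  define q where "q = e2pi \<tau>"
  have q: "norm q < 1" using assms by (simp add: q_def norm_e2pi_less_1)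
  have small: "\<forall>\<^sub>F n in sequentially. norm (w * q ^ Suc n) < 1 / 2" for w
  proof -
    have "(\<lambda>n. norm (w * q ^ Suc n)) \<longlonglongrightarrow> norm (w * 0)"
      by (intro tendsto_intros LIMSEQ_Suc LIMSEQ_power_zero q)
    thus ?thesis by (rule order_tendstoD) simp
  qed
  show "\<forall>\<^sub>F n in sequentially. norm (pi_cot (z + of_nat (Suc n) * \<tau>) + pi_cot (z - of_nat (Suc n) * \<tau>))
      \<le> norm (four_pi_sin z) * (norm q ^ Suc n / (1 - 1 / 2)\<^sup>2)"
    using small[of "e2pi z"] small[of "e2pi (-z)"]
  proof eventually_elim
    case (elim n)
    have "e2pi z * q ^ Suc n \<noteq> 1" "e2pi (-z) * q ^ Suc n \<noteq> 1"
      using elim by (auto simp del: power_Suc)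
    from pi_cot_add_pi_cot_diff[OF this q_def] have "norm (pi_cot (z + of_nat (Suc n) * \<tau>) + pi_cot (z - of_nat (Suc n) * \<tau>))
      = norm (four_pi_sin z) * norm (summand z q (Suc n))" by (simp only: norm_mult)
    also have "\<dots> \<le> norm (four_pi_sin z) * (norm q ^ Suc n / (1 - 1 / 2)\<^sup>2)"
      using elim by (intro mult_left_mono norm_summand_le) auto
    finally show ?case .
  qed
  show "summable (\<lambda>n. norm (four_pi_sin z) * (norm q ^ Suc n / (1 - 1 / 2)\<^sup>2))"
    unfolding power_Suc using q by (intro summable_mult summable_divide summable_geometric) auto
qed

lemma Eis1_eq_power_sum:
  assumes "\<bar>Im z\<bar> < Im \<tau>"
  shows "Eis1 \<tau> z = pi_cot z + four_pi_sin z * power_sum z (e2pi \<tau>) 1"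
proof -
  define q where "q = e2pi \<tau>"
  have strip: "in_strip z q" using assms by (simp add: q_def in_strip_iff)
  have "pi_cot (z + of_nat (Suc n) * \<tau>) + pi_cot (z - of_nat (Suc n) * \<tau>) =
      four_pi_sin z * summand z q (Suc n) ^ 1" for n
  proof -
    have "(1 - e2pi z * q ^ Suc n) * (1 - e2pi (-z) * q ^ Suc n) \<noteq> 0"
      using summand_denominator_nonzero[OF strip zero_less_Suc] unfolding summand_denominator .
    hence "e2pi z * q ^ Suc n \<noteq> 1" "e2pi (-z) * q ^ Suc n \<noteq> 1" by auto
    from pi_cot_add_pi_cot_diff[OF this q_def] show ?thesis by simp
  qed
  moreover have "(\<lambda>n. four_pi_sin z * summand z q (Suc n) ^ 1) sums (four_pi_sin z * power_sum z q 1)"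
    by (intro sums_mult power_sum_sums strip) simp
  ultimately show ?thesis
    unfolding Eis1_def q_def by (simp add: sums_iff)
qed

lemma Eis1_minus:
  assumes "Im \<tau> > 0"
  shows "Eis1 \<tau> (-z) = - Eis1 \<tau> z"
proof -
  have "pi_cot (- z + w) + pi_cot (- z - w) = - (pi_cot (z + w) + pi_cot (z - w))" for w
  proof -
    have *: "- z + w = - (z - w)" "- z - w = - (z + w)" by simp_all
    show ?thesis by (simp only: * pi_cot_minus) simp
  qed
  thus ?thesis
    unfolding Eis1_def using suminf_minus[OF summable_Eis1[OF assms]] by (simp del: of_nat_Suc)
qed

lemma Eis1_add_of_int [simp]: "Eis1 \<tau> (z + of_int n) = Eis1 \<tau> z"
proof -
  have "pi_cot (z + of_int n + w) = pi_cot (z + w)" "pi_cot (z + of_int n - w) = pi_cot (z - w)" for w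
    using pi_cot_add_of_int[of "z + w" n] pi_cot_add_of_int[of "z - w" n]
    by (simp_all add: algebra_simps)
  thus ?thesis by (simp add: Eis1_def del: of_nat_Suc)
qed

lemma pi_cot_tendsto:
  assumes "Im \<tau> > 0"
  shows "(\<lambda>n. pi_cot (z + of_nat n * \<tau>)) \<longlonglongrightarrow> - of_real pi * \<i>"
    "(\<lambda>n. pi_cot (z - of_nat n * \<tau>)) \<longlonglongrightarrow> of_real pi * \<i>"
proof -
  have *: "(\<lambda>n. pi_cot (z + of_nat n * \<tau>)) \<longlonglongrightarrow> - of_real pi * \<i>" for z
  proof -
    have "(\<lambda>n. of_real pi * \<i> * (e2pi z * e2pi \<tau> ^ n + 1) / (e2pi z * e2pi \<tau> ^ n - 1)) \<longlonglongrightarrow>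
        of_real pi * \<i> * (e2pi z * 0 + 1) / (e2pi z * 0 - 1)"
      by (intro tendsto_intros LIMSEQ_power_zero norm_e2pi_less_1 assms) auto
    thus ?thesis by (simp add: pi_cot_eq e2pi_add e2pi_of_nat_mult)
  qed
  show "(\<lambda>n. pi_cot (z + of_nat n * \<tau>)) \<longlonglongrightarrow> - of_real pi * \<i>" by (rule *)
  have "pi_cot (z - of_nat n * \<tau>) = - pi_cot (- z + of_nat n * \<tau>)" for n
    using pi_cot_minus[of "- z + of_nat n * \<tau>"] by simp
  thus "(\<lambda>n. pi_cot (z - of_nat n * \<tau>)) \<longlonglongrightarrow> of_real pi * \<i>"
    using tendsto_minus[OF *[of "-z"]] by simp
qed

text \<open>
  The shift moves the symmetric partial sums by one place. They change by their two boundary terms,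
  and these tend to the values \<open>-\<pi> \<i>\<close> and \<open>\<pi> \<i>\<close> of the cotangent at the two ends of a vertical
  line.
\<close>

lemma Eis1_add_tau:
  assumes "Im \<tau> > 0"
  shows "Eis1 \<tau> (z + \<tau>) = Eis1 \<tau> z - 2 * of_real pi * \<i>"
proof -
  define S where "S z M = pi_cot z +
    (\<Sum>n<M. pi_cot (z + of_nat (Suc n) * \<tau>) + pi_cot (z - of_nat (Suc n) * \<tau>))" for z M
  have lim: "S z \<longlonglongrightarrow> Eis1 \<tau> z" for z
    unfolding S_def[abs_def] Eis1_def
    by (intro tendsto_intros summable_LIMSEQ summable_Eis1 assms)
  have diff: "S (z + \<tau>) M - S z M = pi_cot (z + \<tau> + of_nat M * \<tau>) - pi_cot (z - of_nat M * \<tau>)" for M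
  proof (induction M)
    case (Suc M)
    have *: "z + \<tau> + of_nat M * \<tau> = z + of_nat (Suc M) * \<tau>"
      "z + \<tau> - of_nat (Suc M) * \<tau> = z - of_nat M * \<tau>"
      by (simp_all add: algebra_simps)
    have "S (z + \<tau>) (Suc M) - S z (Suc M) = (S (z + \<tau>) M - S z M)
        + pi_cot (z + \<tau> - of_nat (Suc M) * \<tau>) - pi_cot (z + of_nat (Suc M) * \<tau>)
        + (pi_cot (z + \<tau> + of_nat (Suc M) * \<tau>) - pi_cot (z - of_nat (Suc M) * \<tau>))"
      by (simp add: S_def del: of_nat_Suc)
    thus ?case by (simp only: Suc *) simp
  qed (simp add: S_def)
  have "(\<lambda>M. pi_cot (z + \<tau> + of_nat M * \<tau>) - pi_cot (z - of_nat M * \<tau>)) \<longlonglongrightarrow>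
      - of_real pi * \<i> - of_real pi * \<i>"
    by (intro tendsto_diff pi_cot_tendsto assms)
  moreover have "(\<lambda>M. S (z + \<tau>) M - S z M) \<longlonglongrightarrow> Eis1 \<tau> (z + \<tau>) - Eis1 \<tau> z"
    by (intro tendsto_diff lim)
  ultimately have "Eis1 \<tau> (z + \<tau>) - Eis1 \<tau> z = - of_real pi * \<i> - of_real pi * \<i>"
    unfolding diff using LIMSEQ_unique by blast
  thus ?thesis by (simp add: algebra_simps)
qed

lemma Eis1_add_lattice:
  assumes "Im \<tau> > 0"
  shows "Eis1 \<tau> (z + (of_int m * \<tau> + of_int n)) = Eis1 \<tau> z - 2 * of_real pi * \<i> * of_int m"
proof -
  have nat: "Eis1 \<tau> (z + of_nat k * \<tau>) = Eis1 \<tau> z - 2 * of_real pi * \<i> * of_nat k" for k z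
  proof (induction k)
    case (Suc k)
    have "z + of_nat (Suc k) * \<tau> = (z + of_nat k * \<tau>) + \<tau>" by (simp add: algebra_simps)
    thus ?case
      by (simp only: Eis1_add_tau[OF assms] Suc) (simp add: algebra_simps)
  qed simp
  have "Eis1 \<tau> (z + of_int m * \<tau>) = Eis1 \<tau> z - 2 * of_real pi * \<i> * of_int m"
  proof (cases m)
    case (nonneg k)
    thus ?thesis using nat[of z k] by simp
  next
    case (neg k)
    have m: "of_int m = - (of_nat (Suc k) :: complex)" by (simp add: neg)
    have *: "z + of_int m * \<tau> + of_nat (Suc k) * \<tau> = z" by (simp add: m algebra_simps)
    have "Eis1 \<tau> (z + of_int m * \<tau>) = Eis1 \<tau> z + 2 * of_real pi * \<i> * of_nat (Suc k)"
      using nat[of "z + of_int m * \<tau>" "Suc k", unfolded *] by (simp only: eq_diff_eq)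
    thus ?thesis by (simp only:) (simp add: m algebra_simps)
  qed
  thus ?thesis using Eis1_add_of_int[of \<tau> "z + of_int m * \<tau>" n] by (simp add: add.assoc)
qed

definition lattice :: "complex \<Rightarrow> complex set" where
  "lattice \<tau> = {of_int m * \<tau> + of_int n | m n. True}"

lemma reduce_to_strip:
  assumes "Im \<tau> > 0"
  obtains m :: int where "0 \<le> Im (z - of_int m * \<tau>)" "Im (z - of_int m * \<tau>) < Im \<tau>"
proof (rule that[of "\<lfloor>Im z / Im \<tau>\<rfloor>"])
  have "of_int \<lfloor>Im z / Im \<tau>\<rfloor> * Im \<tau> \<le> Im z"
    using of_int_floor_le[of "Im z / Im \<tau>"] assms by (simp only: pos_le_divide_eq)
  moreover have "Im z < (of_int \<lfloor>Im z / Im \<tau>\<rfloor> + 1) * Im \<tau>"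
  proof -
    have "Im z / Im \<tau> < of_int \<lfloor>Im z / Im \<tau>\<rfloor> + 1" by linarith
    thus ?thesis using assms by (simp only: pos_divide_less_eq)
  qed
  ultimately show "0 \<le> Im (z - of_int \<lfloor>Im z / Im \<tau>\<rfloor> * \<tau>)"
    "Im (z - of_int \<lfloor>Im z / Im \<tau>\<rfloor> * \<tau>) < Im \<tau>"
    by (simp_all add: ring_distribs)
qed

lemma sin_pi_eq_0_iff: "sin (of_real pi * z) = 0 \<longleftrightarrow> z \<in> (\<int> :: complex set)"
  unfolding sin_eq_0 by (auto simp: mult.commute elim!: Ints_cases)

lemma holomorphic_pi_cot: "pi_cot holomorphic_on - \<int>"
  unfolding pi_cot_def[abs_def] cot_def by (intro holomorphic_intros) (auto simp: sin_pi_eq_0_iff)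

lemma holomorphic_four_pi_sin [holomorphic_intros]: "four_pi_sin holomorphic_on A"
  unfolding four_pi_sin_def[abs_def] by (intro holomorphic_intros)

lemma open_Im_strip: "open {z. \<bar>Im z\<bar> < y}"
  by (intro open_Collect_less continuous_intros)

lemma holomorphic_power_sum_z:
  assumes "k > 0"
  shows "(\<lambda>z. power_sum z (e2pi \<tau>) k) holomorphic_on {z. \<bar>Im z\<bar> < Im \<tau>}"
proof (rule holomorphic_onI)
  fix z assume "z \<in> {z. \<bar>Im z\<bar> < Im \<tau>}"
  hence "in_strip z (e2pi \<tau>)" by (simp add: in_strip_iff)
  hence "(\<lambda>z. power_sum z (e2pi \<tau>) k) field_differentiable at z"
    using has_field_derivative_power_sum[OF _ assms] by (auto simp: field_differentiable_def)
  thus "(\<lambda>z. power_sum z (e2pi \<tau>) k) field_differentiable at z within {z. \<bar>Im z\<bar> < Im \<tau>}"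
    by (rule field_differentiable_at_within)
qed

lemma holomorphic_Eis1_strip:
  "Eis1 \<tau> holomorphic_on ({z. \<bar>Im z\<bar> < Im \<tau>} - \<int>)"
proof (rule holomorphic_transform)
  show "(\<lambda>z. pi_cot z + four_pi_sin z * power_sum z (e2pi \<tau>) 1) holomorphic_on ({z. \<bar>Im z\<bar> < Im \<tau>} - \<int>)"
    by (intro holomorphic_intros holomorphic_on_subset[OF holomorphic_pi_cot]
      holomorphic_on_subset[OF holomorphic_power_sum_z]) auto
qed (simp add: Eis1_eq_power_sum)

lemma open_Im_strip_diff: "open ({z. \<bar>Im z\<bar> < y} - \<int>)"
  by (intro open_Diff open_Im_strip closed_Ints)

lemma Eis1_analytic:
  assumes "Im \<tau> > 0" "z \<notin> lattice \<tau>"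
  shows "Eis1 \<tau> analytic_on {z}"
proof -
  obtain m where m: "0 \<le> Im (z - of_int m * \<tau>)" "Im (z - of_int m * \<tau>) < Im \<tau>"
    using reduce_to_strip[OF assms(1)] .
  define f where "f w = w - of_int m * \<tau>" for w
  have "f z \<notin> \<int>"
  proof
    assume "f z \<in> \<int>"
    then obtain n where "z = of_int m * \<tau> + of_int n" by (auto simp: f_def algebra_simps elim!: Ints_cases)
    thus False using assms(2) by (auto simp: lattice_def)
  qed
  hence "Eis1 \<tau> analytic_on {f z}"
    using m by (intro holomorphic_on_imp_analytic_at[OF holomorphic_Eis1_strip open_Im_strip_diff])
      (auto simp: f_def)
  moreover have "f analytic_on {z}" unfolding f_def by (intro analytic_intros)
  ultimately have "(\<lambda>w. Eis1 \<tau> (f w) - 2 * of_real pi * \<i> * of_int m) analytic_on {z}"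
    by (intro analytic_on_diff analytic_on_const analytic_on_compose[of f _ "Eis1 \<tau>", unfolded o_def]) auto
  moreover have "(\<lambda>w. Eis1 \<tau> (f w) - 2 * of_real pi * \<i> * of_int m) = Eis1 \<tau>"
  proof
    fix w show "Eis1 \<tau> (f w) - 2 * of_real pi * \<i> * of_int m = Eis1 \<tau> w"
      using Eis1_add_lattice[OF assms(1), of "f w" m 0] by (simp add: f_def)
  qed
  ultimately show ?thesis by simp
qed

lemma Eis1_simple_pole:
  assumes "Im \<tau> > 0"
  shows "((\<lambda>z. z * Eis1 \<tau> z) \<longlongrightarrow> 1) (at 0)"
proof -
  have "((\<lambda>z. sin (of_real pi * z)) has_field_derivative cos (of_real pi * 0) * (of_real pi * 1)) (at (0 :: complex))"
    by (intro DERIV_fun_sin DERIV_cmult DERIV_ident)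
  hence "(\<lambda>z::complex. sin (of_real pi * z) / z) \<midarrow>0\<rightarrow> of_real pi"
    by (simp add: has_field_derivative_iff)
  hence "(\<lambda>z. of_real pi * cos (of_real pi * z) / (sin (of_real pi * z) / z)) \<midarrow>0\<rightarrow>
      of_real pi * cos (of_real pi * (0::complex)) / of_real pi"
    by (intro tendsto_intros) auto
  hence 1: "(\<lambda>z. z * pi_cot z) \<midarrow>0\<rightarrow> 1"
    by (simp add: pi_cot_def cot_def mult_ac)
  have "isCont (\<lambda>z. z * (four_pi_sin z * power_sum z (e2pi \<tau>) 1)) 0"
  proof (rule analytic_at_imp_isCont)
    have "(\<lambda>z. z * (four_pi_sin z * power_sum z (e2pi \<tau>) 1)) holomorphic_on {z. \<bar>Im z\<bar> < Im \<tau>}"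
      by (intro holomorphic_intros holomorphic_power_sum_z) simp
    thus "(\<lambda>z. z * (four_pi_sin z * power_sum z (e2pi \<tau>) 1)) analytic_on {0}"
      by (rule holomorphic_on_imp_analytic_at[OF _ open_Im_strip]) (use assms in auto)
  qed
  hence 2: "(\<lambda>z. z * (four_pi_sin z * power_sum z (e2pi \<tau>) 1)) \<midarrow>0\<rightarrow> 0"
    by (simp add: isCont_def)
  have "\<forall>\<^sub>F z in at 0. z \<in> {z. \<bar>Im z\<bar> < Im \<tau>}"
    using open_Im_strip assms by (intro eventually_at_in_open') auto
  hence "\<forall>\<^sub>F z in at 0. z * pi_cot z + z * (four_pi_sin z * power_sum z (e2pi \<tau>) 1) = z * Eis1 \<tau> z"
    by eventually_elim (simp add: Eis1_eq_power_sum ring_distribs)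
  from tendsto_cong[THEN iffD1, OF this tendsto_add[OF 1 2]] show ?thesis by simp
qed

section \<open>Modular transformation of the quasi-elliptic function\<close>

lemma Im_moebius:
  assumes "(a, b, c, d) \<in> SL2Z"
  shows "Im (moebius (a, b, c, d) \<tau>) = Im \<tau> / (norm (of_int c * \<tau> + of_int d))\<^sup>2"
proof -
  have det: "real_of_int a * of_int d - of_int b * of_int c = 1"
    using assms unfolding SL2Z_def by (simp flip: of_int_mult of_int_diff)
  have "Im (moebius (a, b, c, d) \<tau>) =
      (of_int a * Im \<tau> * (of_int c * Re \<tau> + of_int d) - (of_int a * Re \<tau> + of_int b) * (of_int c * Im \<tau>)) /
      (norm (of_int c * \<tau> + of_int d))\<^sup>2"
    by (simp add: moebius_def Im_divide cmod_power2)
  also have "of_int a * Im \<tau> * (of_int c * Re \<tau> + of_int d) - (of_int a * Re \<tau> + of_int b) * (of_int c * Im \<tau>) =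
      Im \<tau> * (real_of_int a * of_int d - of_int b * of_int c)"
    by (simp add: algebra_simps)
  finally show ?thesis by (simp add: det)
qed

lemma Im_moebius_pos:
  assumes "(a, b, c, d) \<in> SL2Z" "Im \<tau> > 0"
  shows "Im (moebius (a, b, c, d) \<tau>) > 0"
  using automorphy_factor_nonzero[OF assms] assms by (simp add: Im_moebius[OF assms(1)])

text \<open>
  The values on a compact rectangle are all values, so Liouville's theorem applies. A rectangle with
  sides \<open>1\<close> and \<open>Im \<tau>\<close> serves as well as the period parallelogram: first the imaginary part is
  reduced by a multiple of \<open>\<tau>\<close>, then the real part by an integer.
\<close>

lemma holomorphic_periodic_imp_constant:
  fixes f :: "complex \<Rightarrow> complex"
  assumes "f holomorphic_on UNIV" "Im \<tau> > 0" "\<And>z w. w \<in> lattice \<tau> \<Longrightarrow> f (z + w) = f z"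
  shows "f z = f 0"
proof -
  define K where "K = cbox 0 (Complex 1 (Im \<tau>))"
  have "\<exists>w\<in>K. f z = f w" for z
  proof -
    obtain m where m: "0 \<le> Im (z - of_int m * \<tau>)" "Im (z - of_int m * \<tau>) < Im \<tau>"
      using reduce_to_strip[OF assms(2)] .
    define n where "n = \<lfloor>Re (z - of_int m * \<tau>)\<rfloor>"
    define w where "w = z - of_int m * \<tau> - of_int n"
    have "Re w \<ge> 0" "Re w \<le> 1" unfolding w_def n_def by simp_all linarith+
    hence "w \<in> K" using m by (simp add: K_def in_cbox_complex_iff w_def)
    moreover have "f (w + (of_int m * \<tau> + of_int n)) = f w"
      by (rule assms(3)) (auto simp: lattice_def)
    hence "f z = f w" by (simp add: w_def)
    ultimately show ?thesis by blast
  qed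
  hence "range f \<subseteq> f ` K" by blast
  moreover have "compact (f ` K)"
    unfolding K_def using assms(1)
    by (intro compact_continuous_image holomorphic_on_imp_continuous_on compact_cbox)
       (auto intro: holomorphic_on_subset)
  ultimately have "bounded (range f)"
    using compact_imp_bounded bounded_subset by blast
  hence "f constant_on UNIV" by (rule Liouville_theorem[OF assms(1)])
  thus ?thesis by (auto simp: constant_on_def)
qed

lemma lattice_eq_0:
  assumes "z \<in> lattice \<tau>" "\<bar>Im z\<bar> < Im \<tau>" "norm z < 1"
  shows "z = 0"
proof -
  obtain m n :: int where z: "z = of_int m * \<tau> + of_int n" using assms(1) by (auto simp: lattice_def)
  have "\<bar>of_int m\<bar> * Im \<tau> < 1 * Im \<tau>"
  proof -
    have "Im \<tau> > 0" using assms(2) by linarith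
    thus ?thesis using assms(2) by (simp add: z abs_mult)
  qed
  hence "\<bar>real_of_int m\<bar> < 1" using assms(2) by (auto simp only: mult_less_cancel_right)
  hence m: "m = 0" by linarith
  hence "\<bar>real_of_int n\<bar> < 1" using assms(3) by (simp add: z norm_of_int)
  hence "n = 0" by linarith
  thus ?thesis using m z by simp
qed

lemma lattice_uminus: "-z \<in> lattice \<tau> \<longleftrightarrow> z \<in> lattice \<tau>"
proof -
  have *: "-z \<in> lattice \<tau>" if "z \<in> lattice \<tau>" for z
  proof -
    obtain m n :: int where "z = of_int m * \<tau> + of_int n" using \<open>z \<in> lattice \<tau>\<close> unfolding lattice_def by blast
    hence "-z = of_int (-m) * \<tau> + of_int (-n)" by simp
    thus ?thesis unfolding lattice_def by blast
  qed
  show ?thesis using *[of z] *[of "-z"] by auto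
qed

lemma lattice_moebius:
  assumes S: "(a, b, c, d) \<in> SL2Z" and \<tau>: "Im \<tau> > 0"
  assumes z: "z / (of_int c * \<tau> + of_int d) \<in> lattice (moebius (a, b, c, d) \<tau>)"
  shows "z \<in> lattice \<tau>"
proof -
  define l where "l = of_int c * \<tau> + of_int d"
  have l: "l \<noteq> 0" unfolding l_def using automorphy_factor_nonzero[OF S \<tau>] .
  obtain m n :: int where "z / l = of_int m * ((of_int a * \<tau> + of_int b) / l) + of_int n"
    using z unfolding lattice_def l_def moebius_def by auto
  hence "z = of_int m * (of_int a * \<tau> + of_int b) + of_int n * l"
    using l by (simp add: field_simps)
  hence "z = of_int (m * a + n * c) * \<tau> + of_int (m * b + n * d)"
    by (simp add: l_def algebra_simps)
  thus ?thesis unfolding lattice_def by blast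
qed

text \<open>
  The difference \<open>D\<close> of the two sides is periodic with respect to the lattice of \<open>\<tau>\<close>, because division
  by \<open>c \<tau> + d\<close> maps this lattice onto that of \<open>\<gamma> \<tau>\<close>, and the increments of the three terms cancel. At \<open>0\<close> the
  residues cancel, so the singularity is removable, and since \<open>D\<close> is odd its limit there is the value
  \<open>D 0 = 0\<close>. By periodicity \<open>D\<close> is entire, and Liouville's theorem gives \<open>D = D 0\<close>.
\<close>

theorem Eis1_moebius:
  assumes S: "(a, b, c, d) \<in> SL2Z" and \<tau>: "Im \<tau> > 0"
  defines "l \<equiv> of_int c * \<tau> + of_int d"
  shows "Eis1 (moebius (a, b, c, d) \<tau>) (z / l) = l * Eis1 \<tau> z + 2 * of_real pi * \<i> * of_int c * z"
proof -
  define \<tau>' where "\<tau>' = moebius (a, b, c, d) \<tau>"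
  define D where "D z = Eis1 \<tau>' (z / l) - l * Eis1 \<tau> z - 2 * of_real pi * \<i> * of_int c * z" for z
  have l: "l \<noteq> 0" unfolding l_def using automorphy_factor_nonzero[OF S \<tau>] .
  have \<tau>': "Im \<tau>' > 0" unfolding \<tau>'_def by (rule Im_moebius_pos[OF S \<tau>])
  have \<tau>'_eq: "\<tau>' = (of_int a * \<tau> + of_int b) / l" by (simp add: \<tau>'_def moebius_def l_def)
  have det: "of_int a * of_int d - of_int b * of_int c = (1 :: complex)"
    using S unfolding SL2Z_def by (simp flip: of_int_mult of_int_diff)
  have to_lattice': "(of_int m * \<tau> + of_int n) / l = of_int (m * d - n * c) * \<tau>' + of_int (n * a - m * b)" for m n
  proof -
    have "of_int (m * d - n * c) * (of_int a * \<tau> + of_int b) + of_int (n * a - m * b) * l =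
        (of_int a * of_int d - of_int b * of_int c) * (of_int m * \<tau> + of_int n)"
      by (simp add: l_def algebra_simps)
    thus ?thesis using l by (simp add: \<tau>'_eq det field_simps)
  qed
  have periodic: "D (z + w) = D z" if "w \<in> lattice \<tau>" for z w
  proof -
    obtain m n :: int where w: "w = of_int m * \<tau> + of_int n"
      using \<open>w \<in> lattice \<tau>\<close> unfolding lattice_def by blast
    have "(z + w) / l = z / l + w / l" by (rule add_divide_distrib)
    also have "w / l = of_int (m * d - n * c) * \<tau>' + of_int (n * a - m * b)"
      unfolding w by (rule to_lattice')
    finally have E1: "Eis1 \<tau>' ((z + w) / l) = Eis1 \<tau>' (z / l) - 2 * of_real pi * \<i> * of_int (m * d - n * c)"
      by (simp only: Eis1_add_lattice[OF \<tau>'])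
    have E2: "Eis1 \<tau> (z + w) = Eis1 \<tau> z - 2 * of_real pi * \<i> * of_int m"
      unfolding w by (rule Eis1_add_lattice[OF \<tau>])
    show ?thesis
      unfolding D_def E1 E2 by (simp add: w l_def algebra_simps)
  qed
  have away: "D analytic_on {z}" if "z \<notin> lattice \<tau>" for z
  proof -
    have "z / l \<notin> lattice \<tau>'"
      unfolding \<tau>'_def l_def using lattice_moebius[OF S \<tau>] that by blast
    hence "Eis1 \<tau>' analytic_on {z / l}" by (rule Eis1_analytic[OF \<tau>'])
    moreover have "(\<lambda>z. z / l) analytic_on {z}" using l by (intro analytic_intros) auto
    ultimately have "(\<lambda>z. Eis1 \<tau>' (z / l)) analytic_on {z}"
      using analytic_on_compose[of "\<lambda>z. z / l" "{z}" "Eis1 \<tau>'"] by (simp add: o_def)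
    thus ?thesis unfolding D_def[abs_def]
      by (intro analytic_intros Eis1_analytic \<tau> that)
  qed
  have D_minus: "D (-z) = - D z" for z
    using Eis1_minus[OF \<tau>, of z] Eis1_minus[OF \<tau>', of "z / l"] by (simp add: D_def)
  hence D_0: "D 0 = 0" using D_minus[of 0] by simp
  have "D analytic_on {0}"
  proof -
    \<comment> \<open>The disc of this radius contains no lattice point besides \<open>0\<close>.\<close>
    define r where "r = min 1 (Im \<tau>)"
    have r: "r > 0" using \<tau> by (simp add: r_def)
    have "D holomorphic_on (ball 0 r - {0})"
    proof (rule analytic_imp_holomorphic, subst analytic_on_analytic_at, rule ballI, rule away)
      fix z :: complex assume z: "z \<in> ball 0 r - {0}"
      show "z \<notin> lattice \<tau>"
        using lattice_eq_0[of z \<tau>] abs_Im_le_cmod[of z] z by (auto simp: r_def)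
    qed
    moreover have "((\<lambda>z. (z - 0) * D z) \<longlongrightarrow> 0) (at 0)"
    proof -
      have "filterlim (\<lambda>z. z / l) (at 0) (at 0)"
        using l by (intro filterlim_atI tendsto_eq_intros) (auto simp: eventually_at_filter)
      from filterlim_compose[OF Eis1_simple_pole[OF \<tau>'] this]
      have "((\<lambda>z. l * (z / l * Eis1 \<tau>' (z / l)) - l * (z * Eis1 \<tau> z) -
            2 * of_real pi * \<i> * of_int c * z * z) \<longlongrightarrow>
          l * 1 - l * 1 - 2 * of_real pi * \<i> * of_int c * 0 * 0) (at 0)"
        by (intro tendsto_intros Eis1_simple_pole \<tau>)
      thus ?thesis using l by (simp add: D_def algebra_simps)
    qed
    ultimately obtain g where g: "g holomorphic_on ball 0 r" "\<forall>z\<in>ball 0 r - {0}. g z = D z"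
      using holomorphic_on_extend_lim[of D "ball 0 r" 0] r by auto
    have "g 0 = 0"
    proof -
      have cont: "isCont g 0"
        by (intro analytic_at_imp_isCont holomorphic_on_imp_analytic_at[OF g(1)]) (use r in auto)
      have "filterlim uminus (at 0) (at (0 :: complex))"
        by (intro filterlim_atI tendsto_eq_intros) (auto simp: eventually_at_filter)
      with cont have "((\<lambda>z. g z + g (-z)) \<longlongrightarrow> g 0 + g 0) (at 0)"
        unfolding isCont_def by (intro tendsto_add) (auto dest: filterlim_compose)
      moreover have "\<forall>\<^sub>F z in at 0. g z + g (-z) = 0"
      proof -
        have "\<forall>\<^sub>F z in at 0. z \<in> ball 0 r - {0}"
          using r by (intro eventually_at_in_open) auto
        thus ?thesis by eventually_elim (use g(2) D_minus in auto)
      qed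
      hence "((\<lambda>z. g z + g (-z)) \<longlongrightarrow> 0) (at 0)"
        by (rule tendsto_eventually)
      ultimately have "g 0 + g 0 = 0" using tendsto_unique[OF trivial_limit_at] by blast
      thus ?thesis by simp
    qed
    with g(2) D_0 have "D z = g z" if "z \<in> ball 0 r" for z
      using that by (cases "z = 0") auto
    hence "D holomorphic_on ball 0 r" using g(1) holomorphic_transform by metis
    thus ?thesis by (rule holomorphic_on_imp_analytic_at) (use r in auto)
  qed
  have "D analytic_on {z}" for z
  proof (cases "z \<in> lattice \<tau>")
    case True
    have "(\<lambda>w. w + (-z)) analytic_on {z}" by (intro analytic_intros)
    moreover have "D analytic_on (\<lambda>w. w + (-z)) ` {z}" using \<open>D analytic_on {0}\<close> by simp
    ultimately have "D \<circ> (\<lambda>w. w + (-z)) analytic_on {z}" by (rule analytic_on_compose)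
    moreover have "D \<circ> (\<lambda>w. w + (-z)) = D"
      unfolding o_def by (rule ext, rule periodic) (use True in \<open>simp only: lattice_uminus\<close>)
    ultimately show ?thesis by simp
  qed (rule away)
  hence "D analytic_on UNIV" by (subst analytic_on_analytic_at) blast
  hence "D holomorphic_on UNIV" by (rule analytic_imp_holomorphic)
  hence "D z = 0" using holomorphic_periodic_imp_constant[OF _ \<tau> periodic, of z] D_0 by simp
  thus ?thesis by (simp add: D_def \<tau>'_def algebra_simps)
qed

section \<open>Values of the derivatives at torsion points\<close>

lemma higher_deriv_compose_affine_at:
  assumes "f analytic_on {u * z + c}"
  shows "(deriv ^^ n) (\<lambda>w. f (u * w + c)) z = u ^ n * (deriv ^^ n) f (u * z + c)"
proof -
  obtain T where T: "open T" "u * z + c \<in> T" "f holomorphic_on T"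
    using assms unfolding analytic_at by blast
  have "open ((\<lambda>w. u * w + c) -` T)"
    using T(1) by (intro open_vimage continuous_intros)
  thus ?thesis using T
    by (intro higher_deriv_compose_linear'[where S = "(\<lambda>w. u * w + c) -` T" and T = T]) auto
qed

lemma lattice_add_cancel:
  assumes "w \<in> lattice \<tau>" "z + w \<in> lattice \<tau>"
  shows "z \<in> lattice \<tau>"
proof -
  obtain m n :: int where "w = of_int m * \<tau> + of_int n"
    using assms(1) unfolding lattice_def by blast
  moreover obtain m' n' :: int where "z + w = of_int m' * \<tau> + of_int n'"
    using assms(2) unfolding lattice_def by blast
  ultimately have "z = of_int (m' - m) * \<tau> + of_int (n' - n)"
    by (simp add: algebra_simps)
  thus ?thesis unfolding lattice_def by blast
qed

lemma higher_deriv_Eis1_add_lattice: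
  assumes "Im \<tau> > 0" "z \<notin> lattice \<tau>"
  shows "(deriv ^^ k) (Eis1 \<tau>) (z + (of_int m * \<tau> + of_int n)) =
    (deriv ^^ k) (Eis1 \<tau>) z - (if k = 0 then 2 * of_real pi * \<i> * of_int m else 0)"
proof -
  define w where "w = of_int m * \<tau> + of_int n"
  have "w \<in> lattice \<tau>" unfolding lattice_def w_def by blast
  hence "z + w \<notin> lattice \<tau>" using lattice_add_cancel assms(2) by blast
  hence "Eis1 \<tau> analytic_on {z + w}" by (rule Eis1_analytic[OF assms(1)])
  hence "(deriv ^^ k) (\<lambda>u. Eis1 \<tau> (1 * u + w)) z = 1 ^ k * (deriv ^^ k) (Eis1 \<tau>) (1 * z + w)"
    by (intro higher_deriv_compose_affine_at) simp
  moreover have "(\<lambda>u. Eis1 \<tau> (1 * u + w)) = (\<lambda>u. Eis1 \<tau> u - 2 * of_real pi * \<i> * of_int m)"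
    unfolding w_def mult_1 by (rule ext, rule Eis1_add_lattice[OF assms(1)])
  moreover have "(deriv ^^ k) (\<lambda>u. Eis1 \<tau> u - 2 * of_real pi * \<i> * of_int m) z =
      (deriv ^^ k) (Eis1 \<tau>) z - (deriv ^^ k) (\<lambda>u. 2 * of_real pi * \<i> * of_int m) z"
    by (intro higher_deriv_diff_at Eis1_analytic assms analytic_on_const)
  ultimately show ?thesis by (simp add: w_def)
qed

lemma higher_deriv_Eis1_minus:
  assumes "Im \<tau> > 0" "z \<notin> lattice \<tau>"
  shows "(deriv ^^ k) (Eis1 \<tau>) (-z) = (-1) ^ Suc k * (deriv ^^ k) (Eis1 \<tau>) z"
proof -
  have "-z \<notin> lattice \<tau>" using assms(2) by (simp add: lattice_uminus)
  hence "(deriv ^^ k) (\<lambda>u. Eis1 \<tau> ((-1) * u + 0)) z = (-1) ^ k * (deriv ^^ k) (Eis1 \<tau>) ((-1) * z + 0)"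
    by (intro higher_deriv_compose_affine_at) (simp add: Eis1_analytic[OF assms(1)])
  moreover have "(\<lambda>u. Eis1 \<tau> ((-1) * u + 0)) = (\<lambda>u. - Eis1 \<tau> u)"
    by (simp add: Eis1_minus[OF assms(1)])
  moreover have "(deriv ^^ k) (\<lambda>u. - Eis1 \<tau> u) z = - (deriv ^^ k) (Eis1 \<tau>) z"
    by (intro higher_deriv_uminus_at Eis1_analytic assms)
  ultimately have "- (deriv ^^ k) (Eis1 \<tau>) z = (-1) ^ k * (deriv ^^ k) (Eis1 \<tau>) (-z)" by simp
  hence "(-1) ^ k * - (deriv ^^ k) (Eis1 \<tau>) z = ((-1) ^ k * (-1) ^ k) * (deriv ^^ k) (Eis1 \<tau>) (-z)"
    by (simp only: mult.assoc)
  thus ?thesis by (simp flip: power_mult_distrib)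
qed

lemma higher_deriv_Eis1_moebius:
  assumes S: "(a, b, c, d) \<in> SL2Z" and \<tau>: "Im \<tau> > 0" and z: "z \<notin> lattice \<tau>"
  defines "l \<equiv> of_int c * \<tau> + of_int d"
  shows "(deriv ^^ k) (Eis1 (moebius (a, b, c, d) \<tau>)) (z / l) =
    l ^ Suc k * (deriv ^^ k) (Eis1 \<tau>) z +
    2 * of_real pi * \<i> * of_int c * l ^ k * (if k = 0 then z else if k = 1 then 1 else 0)"
proof -
  define \<tau>' where "\<tau>' = moebius (a, b, c, d) \<tau>"
  have l: "l \<noteq> 0" unfolding l_def using automorphy_factor_nonzero[OF S \<tau>] .
  have \<tau>': "Im \<tau>' > 0" unfolding \<tau>'_def by (rule Im_moebius_pos[OF S \<tau>])
  have "z / l \<notin> lattice \<tau>'"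
    using lattice_moebius[OF S \<tau>] z by (auto simp: \<tau>'_def l_def)
  hence A: "(deriv ^^ k) (\<lambda>u. Eis1 \<tau>' (1 / l * u + 0)) z = (1 / l) ^ k * (deriv ^^ k) (Eis1 \<tau>') (1 / l * z + 0)"
    by (intro higher_deriv_compose_affine_at) (simp add: Eis1_analytic[OF \<tau>'])
  have B: "(\<lambda>u. Eis1 \<tau>' (1 / l * u + 0)) =
      (\<lambda>u. l * Eis1 \<tau> u + 2 * of_real pi * \<i> * of_int c * u)"
    using Eis1_moebius[OF S \<tau>] by (simp add: \<tau>'_def l_def)
  have C: "(deriv ^^ k) (\<lambda>u. l * Eis1 \<tau> u + 2 * of_real pi * \<i> * of_int c * u) z =
      l * (deriv ^^ k) (Eis1 \<tau>) z + (deriv ^^ k) (\<lambda>u. 2 * of_real pi * \<i> * of_int c * u) z"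
  proof -
    have "(\<lambda>u. l * Eis1 \<tau> u) analytic_on {z}" "(\<lambda>u. 2 * of_real pi * \<i> * of_int c * u) analytic_on {z}"
      by (intro analytic_intros Eis1_analytic \<tau> z)+
    from higher_deriv_add_at[OF this] show ?thesis
      by (simp only: higher_deriv_cmult'[OF Eis1_analytic[OF \<tau> z]])
  qed
  have "(1 / l) ^ k * (deriv ^^ k) (Eis1 \<tau>') (z / l) = l * (deriv ^^ k) (Eis1 \<tau>) z +
      2 * of_real pi * \<i> * of_int c * (if k = 0 then z else if k = 1 then 1 else 0)"
    using A[unfolded B C, symmetric] by simp
  hence "(l ^ k * (1 / l) ^ k) * (deriv ^^ k) (Eis1 \<tau>') (z / l) = l ^ k * (l * (deriv ^^ k) (Eis1 \<tau>) z +
      2 * of_real pi * \<i> * of_int c * (if k = 0 then z else if k = 1 then 1 else 0))"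
    by (simp only: mult.assoc)
  moreover have "l ^ k * (1 / l) ^ k = 1" using l by (simp flip: power_mult_distrib)
  ultimately show ?thesis unfolding \<tau>'_def by (simp add: algebra_simps)
qed

text \<open>
  Otherwise \<open>N\<close> would divide both \<open>c\<close> and \<open>d\<close>, hence the determinant.
\<close>

lemma torsion_point_notin_lattice:
  assumes S: "(a, b, c, d) \<in> SL2Z" and \<tau>: "Im \<tau> > 0" and N: "N \<ge> (2 :: nat)"
  shows "(of_int c * \<tau> + of_int d) / of_nat N \<notin> lattice \<tau>"
proof
  assume "(of_int c * \<tau> + of_int d) / of_nat N \<in> lattice \<tau>"
  then obtain m n :: int where "(of_int c * \<tau> + of_int d) / of_nat N = of_int m * \<tau> + of_int n"
    unfolding lattice_def by blast
  hence "of_int c * \<tau> + of_int d = of_nat N * (of_int m * \<tau> + of_int n)"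
    using N by (simp add: field_simps)
  hence eq: "of_int c * \<tau> + of_int d = of_int (int N * m) * \<tau> + of_int (int N * n)"
    by (simp add: algebra_simps)
  have "Im (of_int c * \<tau> + of_int d) = Im (of_int (int N * m) * \<tau> + of_int (int N * n))"
    by (simp only: eq)
  hence "real_of_int c = of_int (int N * m)" using \<tau> by simp
  hence c: "c = int N * m" by (simp only: of_int_eq_iff)
  have "complex_of_int d = of_int (int N * n)" using eq by (simp add: c)
  hence d: "d = int N * n" by (simp only: of_int_eq_iff)
  have "1 = int N * (a * n - b * m)"
    using S by (simp add: SL2Z_def c d algebra_simps)
  hence "int N dvd 1" by (rule dvdI)
  thus False using N by simp
qed

lemma inverse_notin_lattice:
  assumes "Im \<tau> > 0" "N \<ge> (2 :: nat)"
  shows "1 / of_nat N \<notin> lattice \<tau>"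
  using torsion_point_notin_lattice[of 1 0 0 1 \<tau> N] assms by (simp add: SL2Z_def)

text \<open>
  The transformation formula at \<open>z = (c \<tau> + d) / N\<close>, which equals \<open>\<epsilon> / N\<close> up to the lattice. For
  \<open>k = 0\<close> the term \<open>2 \<pi> \<i> c z\<close> cancels against the quasi-period of the lattice shift, for \<open>k = 1\<close> its
  derivative remains, and for larger \<open>k\<close> it has disappeared.
\<close>

lemma higher_deriv_Eis1_Gamma0:
  assumes G: "(a, b, c, d) \<in> Gamma0 N" and \<tau>: "Im \<tau> > 0" and N: "N \<ge> 2"
  assumes \<epsilon>: "\<epsilon> = 1 \<or> \<epsilon> = -1" "int N dvd d - \<epsilon>"
  defines "l \<equiv> of_int c * \<tau> + of_int d"
  shows "(deriv ^^ k) (Eis1 (moebius (a, b, c, d) \<tau>)) (1 / of_nat N) =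
    of_int \<epsilon> ^ Suc k * l ^ Suc k *
      ((deriv ^^ k) (Eis1 \<tau>) (1 / of_nat N) + (if k = 1 then 2 * of_real pi * \<i> * (of_int c / l) else 0))"
proof -
  have S: "(a, b, c, d) \<in> SL2Z" using G by (simp add: Gamma0_def)
  obtain m where m: "c = int N * m" using G by (auto simp: Gamma0_def)
  obtain n where n: "d - \<epsilon> = int N * n" using \<epsilon>(2) by (elim dvdE)
  have l: "l \<noteq> 0" unfolding l_def using automorphy_factor_nonzero[OF S \<tau>] .
  have N0: "of_nat N \<noteq> (0 :: complex)" using N by simp
  have d: "d = int N * n + \<epsilon>" using n by simp
  have split: "l / of_nat N = of_int \<epsilon> * (1 / of_nat N) + (of_int m * \<tau> + of_int n)"
    using N0 by (simp add: l_def m d field_simps)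
  have N_notin: "1 / of_nat N \<notin> lattice \<tau>" by (rule inverse_notin_lattice[OF \<tau> N])
  have notin: "of_int \<epsilon> * (1 / of_nat N) \<notin> lattice \<tau>"
    using \<epsilon>(1) N_notin lattice_uminus[of "1 / of_nat N" \<tau>] by auto
  have sign: "(deriv ^^ k) (Eis1 \<tau>) (of_int \<epsilon> * (1 / of_nat N)) =
      of_int \<epsilon> ^ Suc k * (deriv ^^ k) (Eis1 \<tau>) (1 / of_nat N)"
    using \<epsilon>(1) higher_deriv_Eis1_minus[OF \<tau> N_notin, of k] by auto
  have "(deriv ^^ k) (Eis1 (moebius (a, b, c, d) \<tau>)) (1 / of_nat N) =
      (deriv ^^ k) (Eis1 (moebius (a, b, c, d) \<tau>)) (l / of_nat N / l)"
    using l by simp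
  also have "\<dots> = l ^ Suc k * (deriv ^^ k) (Eis1 \<tau>) (l / of_nat N) +
    2 * of_real pi * \<i> * of_int c * l ^ k * (if k = 0 then l / of_nat N else if k = 1 then 1 else 0)"
    unfolding l_def by (intro higher_deriv_Eis1_moebius torsion_point_notin_lattice[OF S \<tau> N] S \<tau>)
  also have "(deriv ^^ k) (Eis1 \<tau>) (l / of_nat N) =
     of_int \<epsilon> ^ Suc k * (deriv ^^ k) (Eis1 \<tau>) (1 / of_nat N) -
     (if k = 0 then 2 * of_real pi * \<i> * of_int m else 0)"
    unfolding split higher_deriv_Eis1_add_lattice[OF \<tau> notin] sign ..
  finally have main: "(deriv ^^ k) (Eis1 (moebius (a, b, c, d) \<tau>)) (1 / of_nat N) =
     l ^ Suc k * (of_int \<epsilon> ^ Suc k * (deriv ^^ k) (Eis1 \<tau>) (1 / of_nat N) -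
       (if k = 0 then 2 * of_real pi * \<i> * of_int m else 0)) +
     2 * of_real pi * \<i> * of_int c * l ^ k * (if k = 0 then l / of_nat N else if k = 1 then 1 else 0)" .
  consider "k = 0" | "k = 1" | "k \<ge> 2" by linarith
  thus ?thesis
  proof cases
    case 1
    have "complex_of_int c = of_nat N * of_int m" by (simp add: m)
    with 1 N0 show ?thesis unfolding main by (simp add: field_simps)
  next
    case 2
    have "complex_of_int \<epsilon> ^ 2 = 1" using \<epsilon>(1) by auto
    with 2 l show ?thesis unfolding main by (simp add: field_simps power2_eq_square)
  next
    case 3
    thus ?thesis unfolding main by simp
  qed
qed

section \<open>Growth at the cusps\<close>

lemma exp_minus_2pi_le:
  assumes "y \<ge> 1"
  shows "exp (- (2 * pi * y)) \<le> 1 / 2"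
proof -
  have "2 * pi * y \<ge> 1 * 1" using assms pi_ge_two by (intro mult_mono) auto
  hence "2 \<le> exp (2 * pi * y)" using exp_ge_add_one_self[of "2 * pi * y"] by linarith
  thus ?thesis by (simp add: exp_minus field_simps)
qed

lemma norm_pi_cot_le:
  assumes "Im z \<ge> 1"
  shows "norm (pi_cot z) \<le> 3 * pi"
proof -
  have e: "norm (e2pi z) \<le> 1 / 2" unfolding norm_e2pi by (rule exp_minus_2pi_le[OF assms])
  have "norm (e2pi z + 1) \<le> 3 / 2" using e norm_triangle_ineq[of "e2pi z" 1] by simp
  moreover have "norm (e2pi z - 1) \<ge> 1 / 2" using e norm_triangle_ineq3[of "e2pi z" 1] by simp
  ultimately have "norm (e2pi z + 1) / norm (e2pi z - 1) \<le> (3 / 2) / (1 / 2)"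
    by (intro frac_le) auto
  hence "pi * (norm (e2pi z + 1) / norm (e2pi z - 1)) \<le> pi * 3"
    by (intro mult_left_mono) auto
  thus ?thesis by (simp add: pi_cot_eq norm_mult norm_divide mult.commute)
qed

text \<open>
  The sine grows like \<open>exp (2 \<pi> \<bar>Im z\<bar>)\<close>. The power sum compensates this, as it is of size \<open>\<bar>q\<bar>\<close>.
\<close>

lemma norm_four_pi_sin_power_sum_le:
  assumes "\<bar>Im z\<bar> + 1 \<le> Im \<tau>"
  shows "norm (four_pi_sin z * power_sum z (e2pi \<tau>) 1) \<le> 16 * pi"
proof -
  define q where "q = e2pi \<tau>"
  have 1: "norm (e2pi z) * norm q \<le> 1 / 2"
    using exp_minus_2pi_le[of "Im z + Im \<tau>"] assms
    by (simp add: q_def norm_e2pi algebra_simps flip: exp_add)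
  have 2: "norm (e2pi (-z)) * norm q \<le> 1 / 2"
    using exp_minus_2pi_le[of "Im \<tau> - Im z"] assms
    by (simp add: q_def norm_e2pi algebra_simps flip: exp_add)
  have q: "norm q \<le> 1 / 2" by (rule in_strip_bound(1)[OF 1 2]) auto
  have "norm (four_pi_sin z) * norm q \<le> 2 * pi * (norm (e2pi z) + norm (e2pi (-z))) * norm q"
    unfolding four_pi_sin_eq norm_mult
    by (intro mult_right_mono) (auto intro!: mult_left_mono norm_triangle_ineq4)
  also have "\<dots> = 2 * pi * (norm (e2pi z) * norm q + norm (e2pi (-z)) * norm q)"
    by (simp add: algebra_simps)
  also have "\<dots> \<le> 2 * pi * (1 / 2 + 1 / 2)"
    using 1 2 by (intro mult_left_mono add_mono) auto
  finally have sq: "norm (four_pi_sin z) * norm q \<le> 2 * pi" by simp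
  have "norm (power_sum z q 1) \<le> (\<Sum>n. 4 * norm q * norm q ^ n)"
    unfolding power_sum_def
  proof (rule norm_suminf_le)
    fix n
    have "norm (summand z q (Suc n)) \<le> norm q ^ Suc n / (1 - 1 / 2)\<^sup>2"
      by (rule norm_summand_le) (use in_strip_bound[OF 1 2 _ zero_less_Suc[of n]] in auto)
    thus "norm (summand z q (Suc n) ^ 1) \<le> 4 * norm q * norm q ^ n"
      by (simp add: power2_eq_square)
  next
    show "summable (\<lambda>n. 4 * norm q * norm q ^ n)"
      using q by (intro summable_mult summable_geometric) simp
  qed
  also have "\<dots> = 4 * norm q * (1 / (1 - norm q))"
    using q by (subst suminf_mult) (simp_all add: summable_geometric suminf_geometric)
  also have "\<dots> \<le> 4 * norm q * (1 / (1 / 2))"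
    using q by (intro mult_left_mono divide_left_mono) auto
  finally have p: "norm (power_sum z q 1) \<le> 8 * norm q" by simp
  have "norm (four_pi_sin z * power_sum z q 1) \<le> norm (four_pi_sin z) * (8 * norm q)"
    unfolding norm_mult using p by (intro mult_left_mono) auto
  also have "\<dots> \<le> 16 * pi" using sq by (simp add: mult_ac)
  finally show ?thesis by (simp add: q_def)
qed

text \<open>
  For \<open>\<alpha> > 0\<close> the point \<open>\<alpha> \<tau> + \<beta>\<close> moves upwards with \<open>\<tau>\<close>, and the cotangent has a limit there. For
  \<open>\<alpha> = 0\<close> the point stays at \<open>\<beta>\<close>, which must not be a pole.
\<close>

lemma pi_cot_bounded_near_ray:
  fixes \<alpha> \<beta> :: real
  assumes "0 \<le> \<alpha>" "\<alpha> = 0 \<Longrightarrow> \<beta> \<notin> \<int>"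
  obtains \<epsilon> Y B where "0 < \<epsilon>" "\<epsilon> \<le> 1"
    "\<forall>\<tau> z. Im \<tau> \<ge> Y \<longrightarrow> z \<in> cball (of_real \<alpha> * \<tau> + of_real \<beta>) \<epsilon> \<longrightarrow> z \<notin> \<int> \<and> norm (pi_cot z) \<le> B"
proof (cases "\<alpha> = 0")
  case True
  have "of_real \<beta> \<in> - (\<int> :: complex set)" using assms(2)[OF True] by simp
  moreover have "open (- (\<int> :: complex set))" by (intro open_Compl closed_Ints)
  ultimately obtain \<epsilon>0 where \<epsilon>0: "\<epsilon>0 > 0" "cball (of_real \<beta>) \<epsilon>0 \<subseteq> - (\<int> :: complex set)"
    unfolding open_contains_cball by blast
  define \<epsilon> where "\<epsilon> = min \<epsilon>0 1"
  have \<epsilon>: "\<epsilon> > 0" "\<epsilon> \<le> 1" using \<epsilon>0(1) by (simp_all add: \<epsilon>_def)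
  have "cball (of_real \<beta>) \<epsilon> \<subseteq> cball (of_real \<beta> :: complex) \<epsilon>0"
    by (rule subset_cball) (simp add: \<epsilon>_def)
  hence sub: "cball (of_real \<beta>) \<epsilon> \<subseteq> - (\<int> :: complex set)" using \<epsilon>0(2) by (rule subset_trans)
  have "continuous_on (cball (of_real \<beta>) \<epsilon>) pi_cot"
    by (rule holomorphic_on_imp_continuous_on[OF holomorphic_on_subset[OF holomorphic_pi_cot sub]])
  hence "bounded (pi_cot ` cball (of_real \<beta>) \<epsilon>)"
    by (intro compact_imp_bounded compact_continuous_image compact_cball)
  then obtain B where B: "\<forall>w\<in>pi_cot ` cball (of_real \<beta>) \<epsilon>. norm w \<le> B"
    unfolding bounded_iff ..
  show ?thesis
  proof (rule that[of \<epsilon> 0 B]; (intro allI impI)?)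
    fix \<tau> z :: complex assume "z \<in> cball (of_real \<alpha> * \<tau> + of_real \<beta>) \<epsilon>"
    hence z: "z \<in> cball (of_real \<beta>) \<epsilon>" by (simp add: True)
    have "norm (pi_cot z) \<le> B" using B imageI[OF z] by (rule bspec)
    moreover have "z \<notin> \<int>" using subsetD[OF sub z] by simp
    ultimately show "z \<notin> \<int> \<and> norm (pi_cot z) \<le> B" by simp
  qed (rule \<epsilon>)+
next
  case False
  hence \<alpha>: "\<alpha> > 0" using assms(1) by simp
  show ?thesis
  proof (rule that[of 1 "2 / \<alpha>" "3 * pi"]; (intro allI impI)?)
    fix \<tau> z assume \<tau>: "Im \<tau> \<ge> 2 / \<alpha>" and z: "z \<in> cball (of_real \<alpha> * \<tau> + of_real \<beta>) 1"
    have "\<alpha> * Im \<tau> \<ge> 2" using \<tau> \<alpha> by (simp add: field_simps)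
    moreover have "\<bar>Im (of_real \<alpha> * \<tau> + of_real \<beta> - z)\<bar> \<le> 1"
      using z abs_Im_le_cmod[of "of_real \<alpha> * \<tau> + of_real \<beta> - z"] by (simp add: dist_norm)
    ultimately have Im: "Im z \<ge> 1" by simp
    thus "z \<notin> \<int> \<and> norm (pi_cot z) \<le> 3 * pi"
      using norm_pi_cot_le[OF Im] by (auto elim!: Ints_cases)
  qed auto
qed

text \<open>
  On a disc of fixed radius around \<open>\<alpha> \<tau> + \<beta>\<close> the function itself is bounded uniformly in \<open>\<tau>\<close> once
  \<open>Im \<tau>\<close> is large, and Cauchy's inequality transfers this to all derivatives.
\<close>

lemma higher_deriv_Eis1_bounded_fundamental:
  fixes \<alpha> \<beta> :: real
  assumes "0 \<le> \<alpha>" "\<alpha> < 1" "\<alpha> = 0 \<Longrightarrow> \<beta> \<notin> \<int>"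
  shows "\<exists>B Y. \<forall>\<tau>. Im \<tau> \<ge> Y \<longrightarrow> norm ((deriv ^^ k) (Eis1 \<tau>) (of_real \<alpha> * \<tau> + of_real \<beta>)) \<le> B"
proof -
  obtain \<epsilon> Y B where *: "0 < \<epsilon>" "\<epsilon> \<le> 1"
    "\<forall>\<tau> z. Im \<tau> \<ge> Y \<longrightarrow> z \<in> cball (of_real \<alpha> * \<tau> + of_real \<beta>) \<epsilon> \<longrightarrow> z \<notin> \<int> \<and> norm (pi_cot z) \<le> B"
    by (rule pi_cot_bounded_near_ray[OF assms(1,3)])
  \<comment> \<open>This keeps the disc at height at most \<open>Im \<tau> - 1\<close>, inside the strip where the power sum is small.\<close>
  define Y' where "Y' = max Y (2 / (1 - \<alpha>))"
  show ?thesis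
  proof (intro exI allI impI)
    fix \<tau> :: complex assume \<tau>: "Im \<tau> \<ge> Y'"
    define \<xi> where "\<xi> = of_real \<alpha> * \<tau> + of_real \<beta>"
    have "0 < 2 / (1 - \<alpha>)" using assms(2) by simp
    moreover have "2 / (1 - \<alpha>) \<le> Im \<tau>" using \<tau> by (simp add: Y'_def)
    ultimately have "Im \<tau> > 0" by linarith
    have "(1 - \<alpha>) * Im \<tau> \<ge> 2" using \<tau> assms(2) by (simp add: Y'_def field_simps)
    have Im: "\<bar>Im z\<bar> + 1 \<le> Im \<tau>" if "z \<in> cball \<xi> \<epsilon>" for z
    proof -
      have "\<bar>Im (\<xi> - z)\<bar> \<le> norm (\<xi> - z)" by (rule abs_Im_le_cmod)
      also have "\<dots> \<le> 1" using that *(2) by (simp add: dist_norm)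
      finally have "\<bar>\<alpha> * Im \<tau> - Im z\<bar> \<le> 1" by (simp add: \<xi>_def)
      moreover have "\<alpha> * Im \<tau> \<ge> 0"
        using \<open>Im \<tau> > 0\<close> assms(1) by simp
      ultimately show ?thesis using \<open>(1 - \<alpha>) * Im \<tau> \<ge> 2\<close> by (simp add: algebra_simps abs_if split: if_splits)
    qed
    have notin: "z \<notin> \<int>" and cot: "norm (pi_cot z) \<le> B" if "z \<in> cball \<xi> \<epsilon>" for z
      using *(3)[rule_format, of \<tau> z] \<tau> that by (auto simp: Y'_def \<xi>_def)
    have "cball \<xi> \<epsilon> \<subseteq> {z. \<bar>Im z\<bar> < Im \<tau>} - \<int>"
    proof
      fix z assume "z \<in> cball \<xi> \<epsilon>"
      thus "z \<in> {z. \<bar>Im z\<bar> < Im \<tau>} - \<int>" using Im[of z] notin[of z] by simp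
    qed
    hence holo: "Eis1 \<tau> holomorphic_on cball \<xi> \<epsilon>"
      using holomorphic_Eis1_strip holomorphic_on_subset by blast
    show "norm ((deriv ^^ k) (Eis1 \<tau>) (of_real \<alpha> * \<tau> + of_real \<beta>)) \<le> fact k * (B + 16 * pi) / \<epsilon> ^ k"
      unfolding \<xi>_def[symmetric]
    proof (rule Cauchy_inequality)
      show "Eis1 \<tau> holomorphic_on ball \<xi> \<epsilon>"
        using holo by (rule holomorphic_on_subset) auto
      show "continuous_on (cball \<xi> \<epsilon>) (Eis1 \<tau>)"
        using holo by (rule holomorphic_on_imp_continuous_on)
      fix z assume "norm (\<xi> - z) = \<epsilon>"
      hence z: "z \<in> cball \<xi> \<epsilon>" by (simp add: dist_norm)
      have "Eis1 \<tau> z = pi_cot z + four_pi_sin z * power_sum z (e2pi \<tau>) 1"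
        using Im[OF z] by (intro Eis1_eq_power_sum) simp
      thus "norm (Eis1 \<tau> z) \<le> B + 16 * pi"
        using norm_triangle_mono[OF cot[OF z] norm_four_pi_sin_power_sum_le[OF Im[OF z]]] by simp
    qed (use *(1) in auto)
  qed
qed

text \<open>
  A lattice shift by a multiple of \<open>\<tau>\<close> replaces \<open>\<alpha>\<close> by its fractional part and changes the function by
  a constant.
\<close>

lemma higher_deriv_Eis1_bounded:
  fixes \<alpha> \<beta> :: real
  assumes "\<not> (\<alpha> \<in> \<int> \<and> \<beta> \<in> \<int>)"
  shows "\<exists>B Y. \<forall>\<tau>. Im \<tau> \<ge> Y \<longrightarrow> norm ((deriv ^^ k) (Eis1 \<tau>) (of_real \<alpha> * \<tau> + of_real \<beta>)) \<le> B"
proof -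
  define m where "m = \<lfloor>\<alpha>\<rfloor>"
  have "frac \<alpha> = 0 \<Longrightarrow> \<beta> \<notin> \<int>" using assms by (auto simp: frac_eq_0_iff)
  from higher_deriv_Eis1_bounded_fundamental[OF frac_ge_0 frac_lt_1 this]
  obtain B Y where B: "\<And>\<tau>. Im \<tau> \<ge> Y \<Longrightarrow>
    norm ((deriv ^^ k) (Eis1 \<tau>) (of_real (frac \<alpha>) * \<tau> + of_real \<beta>)) \<le> B" by blast
  show ?thesis
  proof (intro exI allI impI)
    fix \<tau> :: complex assume \<tau>: "Im \<tau> \<ge> max Y 1"
    hence pos: "Im \<tau> > 0" by simp
    define \<xi> where "\<xi> = of_real (frac \<alpha>) * \<tau> + of_real \<beta>"
    have eq: "of_real \<alpha> * \<tau> + of_real \<beta> = \<xi> + (of_int m * \<tau> + of_int 0)"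
      by (simp add: \<xi>_def m_def frac_def algebra_simps)
    have "\<xi> \<notin> lattice \<tau>"
    proof
      assume "\<xi> \<in> lattice \<tau>"
      then obtain m' n' :: int where *: "\<xi> = of_int m' * \<tau> + of_int n'"
        unfolding lattice_def by blast
      have "Im \<xi> = Im (of_int m' * \<tau> + of_int n')" by (simp only: *)
      hence frac: "frac \<alpha> = of_int m'" using pos by (simp add: \<xi>_def)
      have "Re \<xi> = Re (of_int m' * \<tau> + of_int n')" by (simp only: *)
      hence "\<beta> = of_int n'" by (simp add: \<xi>_def frac)
      moreover have "\<alpha> = of_int (m + m')"
        using frac unfolding frac_def m_def of_int_add by linarith
      ultimately show False using assms by simp
    qed
    from higher_deriv_Eis1_add_lattice[OF pos this, of k m 0]
    have "norm ((deriv ^^ k) (Eis1 \<tau>) (of_real \<alpha> * \<tau> + of_real \<beta>)) \<le>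
        norm ((deriv ^^ k) (Eis1 \<tau>) \<xi>) + norm (if k = 0 then 2 * of_real pi * \<i> * of_int m else (0 :: complex))"
      unfolding eq by (simp only: norm_triangle_ineq4)
    also have "\<dots> \<le> B + norm (2 * of_real pi * \<i> * complex_of_int m)"
    proof (rule add_mono)
      show "norm ((deriv ^^ k) (Eis1 \<tau>) \<xi>) \<le> B"
        unfolding \<xi>_def by (rule B) (use \<tau> in simp)
    qed simp
    finally show "norm ((deriv ^^ k) (Eis1 \<tau>) (of_real \<alpha> * \<tau> + of_real \<beta>)) \<le> \<dots>" .
  qed
qed

section \<open>Power sums are combinations of derivatives\<close>

text \<open>
  The coefficients of the power sums in the \<open>k\<close>-th derivative of \<open>E\<^sub>1\<close>, as obtained by differentiating
  \<open>4 \<pi> sin (2 \<pi> z) P\<^sub>1\<close> repeatedly with the product rule. Index \<open>j\<close> belongs to \<open>P\<^sub>j\<^sub>+\<^sub>1\<close>; at \<open>j = 0\<close> the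
  truncated \<open>j - 1\<close> does no harm, as the factor \<open>j\<close> vanishes.
\<close>

primrec power_sum_coeff :: "nat \<Rightarrow> nat \<Rightarrow> complex \<Rightarrow> complex" where
  "power_sum_coeff 0 = (\<lambda>j z. if j = 0 then four_pi_sin z else 0)"
| "power_sum_coeff (Suc k) = (\<lambda>j z. deriv (power_sum_coeff k j) z -
     of_nat j * four_pi_sin z * power_sum_coeff k (j - 1) z)"

lemma holomorphic_power_sum_coeff: "power_sum_coeff k j holomorphic_on UNIV"
proof (induction k arbitrary: j)
  case 0
  show ?case by (cases "j = 0") (simp_all add: holomorphic_four_pi_sin)
next
  case (Suc k)
  show ?case unfolding power_sum_coeff.simps
    by (intro holomorphic_on_diff holomorphic_on_mult holomorphic_deriv Suc holomorphic_four_pi_sin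
        holomorphic_on_const open_UNIV)
qed

lemma power_sum_coeff_eq_0: "j > k \<Longrightarrow> power_sum_coeff k j = (\<lambda>z. 0)"
proof (induction k arbitrary: j)
  case (Suc k)
  have "power_sum_coeff k j = (\<lambda>z. 0)" "power_sum_coeff k (j - 1) = (\<lambda>z. 0)"
    using Suc.prems by (auto intro!: Suc.IH)
  thus ?case by simp
qed simp

lemma power_sum_coeff_diag: "power_sum_coeff k k z = (-1) ^ k * fact k * four_pi_sin z ^ Suc k"
  by (induction k) (simp_all add: power_sum_coeff_eq_0 algebra_simps)

text \<open>
  On the right only the power sums depend on \<open>\<tau>\<close>. So for fixed \<open>z\<close> this is a linear system with constant coefficients between
  derivatives of \<open>E\<^sub>1\<close> and power sums, which is triangular by \<open>power_sum_coeff_diag\<close>. It yields the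
  holomorphy of the derivatives in \<open>\<tau>\<close> and, read backwards, the weights of the power sums.
\<close>

lemma higher_deriv_Eis1_eq:
  assumes "\<bar>Im z\<bar> < Im \<tau>" "z \<notin> \<int>"
  shows "(deriv ^^ k) (Eis1 \<tau>) z = (deriv ^^ k) pi_cot z +
    (\<Sum>j\<le>k. power_sum_coeff k j z * power_sum z (e2pi \<tau>) (Suc j))"
  using assms
proof (induction k arbitrary: z)
  case 0
  thus ?case by (simp add: Eis1_eq_power_sum)
next
  case (Suc k)
  define P where "P j = power_sum z (e2pi \<tau>) (Suc j)" for j
  define c where "c j = power_sum_coeff k j z" for j
  define c' where "c' j = deriv (power_sum_coeff k j) z" for j
  have strip: "in_strip z (e2pi \<tau>)" using Suc.prems by (simp add: in_strip_iff)
  have cot: "((deriv ^^ k) pi_cot has_field_derivative (deriv ^^ Suc k) pi_cot z) (at z)"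
    using has_field_derivative_higher_deriv[OF holomorphic_pi_cot, of z k] Suc.prems(2)
    by (simp add: open_Compl closed_Ints)
  have summand: "((\<lambda>z. power_sum_coeff k j z * power_sum z (e2pi \<tau>) (Suc j)) has_field_derivative
      c' j * P j + (- of_nat (Suc j) * four_pi_sin z * P (Suc j)) * c j) (at z)" for j
    unfolding P_def c_def c'_def
    by (intro DERIV_mult has_field_derivative_power_sum strip zero_less_Suc
      holomorphic_derivI[OF holomorphic_power_sum_coeff open_UNIV UNIV_I])
  have "((\<lambda>z. (deriv ^^ k) pi_cot z + (\<Sum>j\<le>k. power_sum_coeff k j z * power_sum z (e2pi \<tau>) (Suc j)))
      has_field_derivative (deriv ^^ Suc k) pi_cot z +
        (\<Sum>j\<le>k. c' j * P j + (- of_nat (Suc j) * four_pi_sin z * P (Suc j)) * c j)) (at z)"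
    by (intro DERIV_add cot DERIV_sum summand)
  hence "((deriv ^^ k) (Eis1 \<tau>) has_field_derivative (deriv ^^ Suc k) pi_cot z +
        (\<Sum>j\<le>k. c' j * P j + (- of_nat (Suc j) * four_pi_sin z * P (Suc j)) * c j)) (at z)"
    by (rule has_field_derivative_transform_within_open[OF _ open_Im_strip_diff[of "Im \<tau>"]])
       (use Suc in auto)
  hence "(deriv ^^ Suc k) (Eis1 \<tau>) z = (deriv ^^ Suc k) pi_cot z +
        (\<Sum>j\<le>k. c' j * P j + (- of_nat (Suc j) * four_pi_sin z * P (Suc j)) * c j)"
    by (simp add: DERIV_imp_deriv)
  also have "(\<Sum>j\<le>k. c' j * P j + (- of_nat (Suc j) * four_pi_sin z * P (Suc j)) * c j) =
      (\<Sum>j\<le>k. c' j * P j) - (\<Sum>j\<le>k. of_nat (Suc j) * four_pi_sin z * c j * P (Suc j))"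
    unfolding sum_subtractf[symmetric] by (intro sum.cong refl) (simp add: mult_ac del: of_nat_Suc)
  also have "(\<Sum>j\<le>k. c' j * P j) = (\<Sum>j\<le>Suc k. c' j * P j)"
    by (simp add: c'_def power_sum_coeff_eq_0)
  also have "(\<Sum>j\<le>k. of_nat (Suc j) * four_pi_sin z * c j * P (Suc j)) =
      (\<Sum>j\<le>Suc k. of_nat j * four_pi_sin z * c (j - 1) * P j)"
    by (simp only: sum.atMost_Suc_shift) (simp del: of_nat_Suc)
  also have "(\<Sum>j\<le>Suc k. c' j * P j) - (\<Sum>j\<le>Suc k. of_nat j * four_pi_sin z * c (j - 1) * P j) =
      (\<Sum>j\<le>Suc k. power_sum_coeff (Suc k) j z * power_sum z (e2pi \<tau>) (Suc j))"
    unfolding sum_subtractf[symmetric]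
    by (intro sum.cong refl) (simp add: c_def c'_def P_def left_diff_distrib)
  finally show ?case .
qed

lemma holomorphic_higher_deriv_Eis1_torsion:
  fixes x :: real
  assumes "x \<notin> \<int>"
  shows "(\<lambda>\<tau>. (deriv ^^ k) (Eis1 \<tau>) (of_real x)) holomorphic_on \<H>"
proof (rule holomorphic_transform)
  have "(\<lambda>\<tau>. power_sum (of_real x) (e2pi \<tau>) (Suc j)) holomorphic_on \<H>" for j
  proof -
    have "(\<lambda>q. power_sum (of_real x) q (Suc j)) \<circ> e2pi holomorphic_on \<H>"
    proof (rule holomorphic_on_compose_gen[OF _ holomorphic_power_sum])
      show "e2pi holomorphic_on \<H>" unfolding e2pi_def[abs_def] by (intro holomorphic_intros)
      show "e2pi ` \<H> \<subseteq> {q. in_strip (of_real x) q}"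
        by (auto simp: in_strip_iff upper_half_plane_def)
    qed simp
    thus ?thesis by (simp add: o_def)
  qed
  thus "(\<lambda>\<tau>. (deriv ^^ k) pi_cot (of_real x) +
      (\<Sum>j\<le>k. power_sum_coeff k j (of_real x) * power_sum (of_real x) (e2pi \<tau>) (Suc j))) holomorphic_on \<H>"
    by (intro holomorphic_intros)
  show "(deriv ^^ k) pi_cot (of_real x) +
      (\<Sum>j\<le>k. power_sum_coeff k j (of_real x) * power_sum (of_real x) (e2pi \<tau>) (Suc j)) =
      (deriv ^^ k) (Eis1 \<tau>) (of_real x)" if "\<tau> \<in> \<H>" for \<tau>
    using that assms by (subst higher_deriv_Eis1_eq) (auto simp: upper_half_plane_def)
qed

lemma quasimodular_lincomb_diff:
  assumes "quasimodular_lincomb k N F" "quasimodular_lincomb k N F'"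
  shows "quasimodular_lincomb k N (\<lambda>\<tau>. F \<tau> - F' \<tau>)"
  using quasimodular_lincomb_add[OF assms(1) quasimodular_lincomb_scale[OF assms(2), of "-1"]] by simp

text \<open>
  Solving the triangular system. Up to a nonzero factor \<open>P\<^sub>k\<^sub>+\<^sub>1\<close> is the \<open>k\<close>-th derivative
  minus a constant and multiples of \<open>P\<^sub>1, \<dots>, P\<^sub>k\<close>, which have smaller weight.
\<close>

lemma quasimodular_lincomb_power_sum:
  fixes x :: real
  assumes x: "x \<notin> \<int>" "four_pi_sin (of_real x) \<noteq> 0"
  assumes const: "\<And>c. quasimodular_lincomb 0 N (\<lambda>_. c)"
  assumes Eis1: "\<And>k. quasimodular_lincomb (int (Suc k)) N (\<lambda>\<tau>. (deriv ^^ k) (Eis1 \<tau>) (of_real x))"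
  shows "quasimodular_lincomb (int (Suc k)) N (\<lambda>\<tau>. power_sum (of_real x) (e2pi \<tau>) (Suc k))"
proof (induction k rule: less_induct)
  case (less k)
  define c where "c j = power_sum_coeff k j (of_real x)" for j
  define P where "P j \<tau> = power_sum (of_real x) (e2pi \<tau>) (Suc j)" for j \<tau>
  define b where "b = (deriv ^^ k) pi_cot (of_real x)"
  have c: "c k \<noteq> 0" using x by (simp add: c_def power_sum_coeff_diag)
  have b: "quasimodular_lincomb (int (Suc k)) N (\<lambda>_. b)"
    by (rule quasimodular_lincomb_mono[OF const]) simp
  have P: "quasimodular_lincomb (int (Suc k)) N (P j)" if "j < k" for j
    by (rule quasimodular_lincomb_mono[of "int (Suc j)"])
       (use less[OF that] that in \<open>simp_all add: P_def[abs_def]\<close>)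
  have "quasimodular_lincomb (int (Suc k)) N
    (\<lambda>\<tau>. inverse (c k) * ((deriv ^^ k) (Eis1 \<tau>) (of_real x) - b - (\<Sum>j<k. c j * P j \<tau>)))"
    by (intro quasimodular_lincomb_scale quasimodular_lincomb_diff quasimodular_lincomb_sum Eis1 b P) simp
  thus ?case
  proof (rule quasimodular_lincomb_cong)
    fix \<tau> assume "\<tau> \<in> \<H>"
    hence "(deriv ^^ k) (Eis1 \<tau>) (of_real x) = b + (\<Sum>j\<le>k. c j * P j \<tau>)"
      unfolding b_def c_def P_def using x by (intro higher_deriv_Eis1_eq) (auto simp: upper_half_plane_def)
    also have "(\<Sum>j\<le>k. c j * P j \<tau>) = (\<Sum>j<k. c j * P j \<tau>) + c k * P k \<tau>"
      unfolding lessThan_Suc_atMost[symmetric] by simp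
    finally show "inverse (c k) * ((deriv ^^ k) (Eis1 \<tau>) (of_real x) - b - (\<Sum>j<k. c j * P j \<tau>)) =
        power_sum (of_real x) (e2pi \<tau>) (Suc k)"
      using c by (simp add: P_def[of k])
  qed
qed

section \<open>Quasimodularity at levels with unit group \<open>{1, -1}\<close>\<close>

text \<open>
  The condition that makes the point \<open>1/N\<close> sufficient: every unit modulo \<open>N\<close> is \<open>1\<close> or \<open>-1\<close>. From
  \<open>N \<ge> 3\<close> it follows that the two are distinct and that \<open>2/N\<close> is not an integer.
\<close>

definition pm_units :: "nat \<Rightarrow> bool" where
  "pm_units N \<longleftrightarrow> N \<ge> 3 \<and> (\<forall>d :: int. coprime d (int N) \<longleftrightarrow> int N dvd d - 1 \<or> int N dvd d + 1)"

text \<open>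
  For \<open>s = 1\<close> the principal character modulo \<open>N\<close>, for \<open>s = -1\<close> the odd one. Odd and even derivatives
  of an odd function need different ones.
\<close>

definition sign_character :: "nat \<Rightarrow> complex \<Rightarrow> int \<Rightarrow> complex" where
  "sign_character N s d = (if int N dvd d - 1 then 1 else if int N dvd d + 1 then s else 0)"

lemma coprime_int_small_iff:
  fixes d :: int
  shows "coprime d 3 \<longleftrightarrow> 3 dvd d - 1 \<or> 3 dvd d + 1"
    "coprime d 4 \<longleftrightarrow> 4 dvd d - 1 \<or> 4 dvd d + 1"
    "coprime d 6 \<longleftrightarrow> 6 dvd d - 1 \<or> 6 dvd d + 1"
proof -
  have 2: "coprime d 2 \<longleftrightarrow> \<not> 2 dvd d" by (metis coprime_commute coprime_left_2_iff_odd)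
  have 3: "coprime d 3 \<longleftrightarrow> \<not> 3 dvd d"
  proof
    assume "\<not> 3 dvd d"
    moreover have "prime (3 :: int)" by simp
    ultimately show "coprime d 3" using prime_imp_coprime coprime_commute by blast
  next
    assume "coprime d 3"
    thus "\<not> 3 dvd d" using coprime_common_divisor[of d 3 3] by auto
  qed
  show "coprime d 3 \<longleftrightarrow> 3 dvd d - 1 \<or> 3 dvd d + 1" unfolding 3 by presburger
  have "coprime d 4 \<longleftrightarrow> coprime d 2"
    using coprime_mult_right_iff[of d 2 2] by simp
  thus "coprime d 4 \<longleftrightarrow> 4 dvd d - 1 \<or> 4 dvd d + 1" unfolding 2 by presburger
  have "coprime d 6 \<longleftrightarrow> coprime d 2 \<and> coprime d 3"
    using coprime_mult_right_iff[of d 2 3] by simp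
  thus "coprime d 6 \<longleftrightarrow> 6 dvd d - 1 \<or> 6 dvd d + 1" unfolding 2 3 by presburger
qed

lemma pm_units_3_4_6: "pm_units 3" "pm_units 4" "pm_units 6"
  by (simp_all add: pm_units_def coprime_int_small_iff)

lemma sign_character_eq:
  assumes "N \<ge> 3" "int N dvd d - \<epsilon>" "\<epsilon> = 1 \<or> \<epsilon> = -1"
  shows "sign_character N s d = (if \<epsilon> = 1 then 1 else s)"
proof (cases "\<epsilon> = 1")
  case True
  thus ?thesis using assms by (simp add: sign_character_def)
next
  case False
  hence "int N dvd d + 1" using assms by simp
  moreover have "\<not> int N dvd d - 1"
  proof
    assume "int N dvd d - 1"
    from dvd_diff[OF \<open>int N dvd d + 1\<close> this] have "int N dvd 2" by simp
    hence "int N \<le> 2" by (rule zdvd_imp_le) simp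
    thus False using assms(1) by simp
  qed
  ultimately show ?thesis using False by (simp add: sign_character_def)
qed

lemma pm_units_obtain_sign:
  assumes "pm_units N" "coprime d (int N)"
  obtains \<epsilon> :: int where "\<epsilon> = 1 \<or> \<epsilon> = -1" "int N dvd d - \<epsilon>"
  using assms that[of 1] that[of "-1"] by (auto simp: pm_units_def)

lemma dirichlet_character_sign:
  assumes N: "pm_units N" and s: "s * s = 1"
  shows "dirichlet_character N (sign_character N s)"
  unfolding dirichlet_character_def
proof (intro conjI allI)
  have N3: "N \<ge> 3" using N by (simp add: pm_units_def)
  have zero: "sign_character N s m = 0 \<longleftrightarrow> \<not> coprime m (int N)" for m
  proof -
    have "s \<noteq> 0" using s by auto
    thus ?thesis using N by (auto simp: sign_character_def pm_units_def)
  qed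
  show "sign_character N s m = 0 \<longleftrightarrow> \<not> coprime m (int N)" for m by (rule zero)
  show "sign_character N s (m + int N) = sign_character N s m" for m
  proof -
    have "m + int N - 1 = (m - 1) + int N" "m + int N + 1 = (m + 1) + int N" by simp_all
    thus ?thesis unfolding sign_character_def by (simp only: dvd_add_triv_right_iff)
  qed
  show "sign_character N s (m * n) = sign_character N s m * sign_character N s n" for m n
  proof (cases "coprime m (int N) \<and> coprime n (int N)")
    case False
    hence "\<not> coprime (m * n) (int N)" by simp
    hence "sign_character N s (m * n) = 0" using zero[of "m * n"] by blast
    moreover have "sign_character N s m = 0 \<or> sign_character N s n = 0"
      using False zero[of m] zero[of n] by blast
    ultimately show ?thesis by auto
  next
    case True
    obtain \<epsilon> :: int where \<epsilon>: "\<epsilon> = 1 \<or> \<epsilon> = -1" "int N dvd m - \<epsilon>"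
      using pm_units_obtain_sign[OF N conjunct1[OF True]] .
    obtain \<delta> :: int where \<delta>: "\<delta> = 1 \<or> \<delta> = -1" "int N dvd n - \<delta>"
      using pm_units_obtain_sign[OF N conjunct2[OF True]] .
    have "m * n - \<epsilon> * \<delta> = (m - \<epsilon>) * n + \<epsilon> * (n - \<delta>)" by (simp add: algebra_simps)
    hence "int N dvd m * n - \<epsilon> * \<delta>" using \<epsilon>(2) \<delta>(2) by simp
    moreover have "\<epsilon> * \<delta> = 1 \<or> \<epsilon> * \<delta> = -1" using \<epsilon>(1) \<delta>(1) by auto
    ultimately have "sign_character N s (m * n) = (if \<epsilon> * \<delta> = 1 then 1 else s)"
      by (rule sign_character_eq[OF N3])
    moreover have "sign_character N s m = (if \<epsilon> = 1 then 1 else s)"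
      by (rule sign_character_eq[OF N3 \<epsilon>(2,1)])
    moreover have "sign_character N s n = (if \<delta> = 1 then 1 else s)"
      by (rule sign_character_eq[OF N3 \<delta>(2,1)])
    ultimately show ?thesis using \<epsilon>(1) \<delta>(1) s by auto
  qed
qed

lemma Gamma0_coprime:
  assumes "(a, b, c, d) \<in> Gamma0 N"
  shows "coprime d (int N)"
proof (rule coprimeI)
  fix e assume e: "e dvd d" "e dvd int N"
  have "int N dvd c" "a * d - b * c = 1" using assms by (auto simp: Gamma0_def SL2Z_def)
  hence "e dvd a * d - b * c" using e by (meson dvd_diff dvd_mult dvd_trans)
  thus "is_unit e" using \<open>a * d - b * c = 1\<close> by simp
qed

lemma Gamma0_obtain_sign:
  assumes "pm_units N" "(a, b, c, d) \<in> Gamma0 N"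
  obtains \<epsilon> :: int where "\<epsilon> = 1 \<or> \<epsilon> = -1" "int N dvd d - \<epsilon>"
  using pm_units_obtain_sign[OF assms(1) Gamma0_coprime[OF assms(2)]] .

text \<open>
  The transformation formula expresses the function at the cusp by a value at \<open>(c \<tau> + d) / N\<close>, which
  is of the form \<open>\<alpha> \<tau> + \<beta>\<close> with \<open>\<alpha> = c / N\<close> and \<open>\<beta> = d / N\<close>. The correction terms are bounded, as
  \<open>\<bar>c\<bar> \<le> \<bar>c \<tau> + d\<bar>\<close> for \<open>Im \<tau> \<ge> 1\<close>.
\<close>

lemma Bfun_higher_deriv_Eis1_cusp:
  assumes S: "(a, b, c, d) \<in> SL2Z" and N: "N \<ge> (2 :: nat)"
  shows "Bfun (\<lambda>\<tau>. (of_int c * \<tau> + of_int d) powi (- int (Suc k)) *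
      (deriv ^^ k) (Eis1 (moebius (a, b, c, d) \<tau>)) (1 / of_nat N)) (filtercomap Im at_top)"
proof -
  define \<alpha> \<beta> where "\<alpha> = real_of_int c / real N" and "\<beta> = real_of_int d / real N"
  have point: "(of_int c * \<tau> + of_int d) / of_nat N = of_real \<alpha> * \<tau> + of_real \<beta>" for \<tau> :: complex
    by (simp add: \<alpha>_def \<beta>_def add_divide_distrib)
  have notin: "\<not> (\<alpha> \<in> \<int> \<and> \<beta> \<in> \<int>)"
  proof
    assume "\<alpha> \<in> \<int> \<and> \<beta> \<in> \<int>"
    then obtain m n :: int where "\<alpha> = of_int m" "\<beta> = of_int n" by (auto elim!: Ints_cases)
    hence "(of_int c * \<i> + of_int d) / of_nat N = of_int m * \<i> + of_int n"
      unfolding point by simp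
    hence "(of_int c * \<i> + of_int d) / of_nat N \<in> lattice \<i>"
      unfolding lattice_def by blast
    thus False using torsion_point_notin_lattice[OF S _ N, of \<i>] by simp
  qed
  obtain B Y where B: "\<And>\<tau>. Im \<tau> \<ge> Y \<Longrightarrow>
    norm ((deriv ^^ k) (Eis1 \<tau>) (of_real \<alpha> * \<tau> + of_real \<beta>)) \<le> B"
    using higher_deriv_Eis1_bounded[OF notin, of k] by blast
  show ?thesis
  proof (rule BfunI)
    show "\<forall>\<^sub>F \<tau> in filtercomap Im at_top. norm ((of_int c * \<tau> + of_int d) powi (- int (Suc k)) *
        (deriv ^^ k) (Eis1 (moebius (a, b, c, d) \<tau>)) (1 / of_nat N)) \<le>
        B + 2 * pi * \<bar>real_of_int c\<bar> / real N + 2 * pi"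
      using eventually_Im_ge[of "max Y 1"]
    proof eventually_elim
      case (elim \<tau>)
      hence \<tau>: "Im \<tau> > 0" "Im \<tau> \<ge> Y" "Im \<tau> \<ge> 1" by auto
      define l where "l = of_int c * \<tau> + of_int d"
      have l: "l \<noteq> 0" unfolding l_def using automorphy_factor_nonzero[OF S \<tau>(1)] .
      have "(deriv ^^ k) (Eis1 (moebius (a, b, c, d) \<tau>)) (1 / of_nat N) =
          (deriv ^^ k) (Eis1 (moebius (a, b, c, d) \<tau>)) (l / of_nat N / l)" using l by simp
      also have "\<dots> = l ^ Suc k * (deriv ^^ k) (Eis1 \<tau>) (l / of_nat N) + 2 * of_real pi * \<i> * of_int c *
          l ^ k * (if k = 0 then l / of_nat N else if k = 1 then 1 else 0)"
        unfolding l_def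
        by (rule higher_deriv_Eis1_moebius[OF S \<tau>(1) torsion_point_notin_lattice[OF S \<tau>(1) N]])
      finally have "l powi (- int (Suc k)) * (deriv ^^ k) (Eis1 (moebius (a, b, c, d) \<tau>)) (1 / of_nat N) =
          (deriv ^^ k) (Eis1 \<tau>) (l / of_nat N) + 2 * of_real pi * \<i> *
          (if k = 0 then of_int c / of_nat N else if k = 1 then of_int c / l else 0)"
        using l by (simp add: power_int_minus power_int_of_nat field_simps del: of_nat_Suc)
      also have "norm \<dots> \<le> norm ((deriv ^^ k) (Eis1 \<tau>) (l / of_nat N)) +
          2 * pi * norm (if k = 0 then of_int c / of_nat N else if k = 1 then of_int c / l else 0)"
        by (rule order_trans[OF norm_triangle_ineq]) (simp add: norm_mult)
      also have "\<dots> \<le> B + 2 * pi * (\<bar>real_of_int c\<bar> / real N + 1)"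
      proof (intro add_mono mult_left_mono)
        show "norm ((deriv ^^ k) (Eis1 \<tau>) (l / of_nat N)) \<le> B"
          unfolding l_def point by (rule B[OF \<tau>(2)])
        have "\<bar>real_of_int c\<bar> * 1 \<le> \<bar>real_of_int c\<bar> * Im \<tau>"
          using \<tau> by (intro mult_left_mono) auto
        also have "\<dots> = \<bar>Im l\<bar>" using \<tau> by (simp add: l_def abs_mult)
        also have "\<dots> \<le> norm l" by (rule abs_Im_le_cmod)
        finally have "norm (of_int c / l) \<le> 1" using l by (simp add: norm_divide)
        thus "norm (if k = 0 then of_int c / of_nat N else if k = 1 then of_int c / l else (0 :: complex)) \<le>
            \<bar>real_of_int c\<bar> / real N + 1"
          by (simp add: norm_divide add_increasing)
      qed simp
      finally show ?case by (simp add: l_def algebra_simps)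
    qed
  qed
qed

lemma quasimodular_form_const:
  assumes "pm_units N"
  shows "quasimodular_form 0 N (\<lambda>_. 1)"
proof -
  have "quasimodular_of 0 0 (sign_character N 1) N (\<lambda>_. 1)"
    unfolding quasimodular_of_def
  proof (intro conjI exI[of _ "\<lambda>_ _. 1"] allI impI ballI; (clarify)?)
    show "\<exists>\<tau>\<in>\<H>. (1 :: complex) \<noteq> 0" by (auto simp: upper_half_plane_def intro!: exI[of _ \<i>])
    fix a b c d \<tau> assume \<gamma>: "(a, b, c, d) \<in> Gamma0 N"
    obtain \<epsilon> :: int where "\<epsilon> = 1 \<or> \<epsilon> = -1" "int N dvd d - \<epsilon>"
      using Gamma0_obtain_sign[OF assms \<gamma>] .
    hence "sign_character N 1 d = 1"
      using sign_character_eq[of N d \<epsilon> 1] assms by (simp add: pm_units_def)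
    thus "1 = sign_character N 1 d * (of_int c * \<tau> + of_int d) powi 0 *
        (\<Sum>j\<le>0. 1 * (of_int c / (of_int c * \<tau> + of_int d)) ^ j)" by simp
  qed auto
  moreover have "dirichlet_character N (sign_character N 1)"
    by (rule dirichlet_character_sign[OF assms]) simp
  ultimately show ?thesis unfolding quasimodular_form_def by blast
qed

text \<open>
  For \<open>k = 1\<close> the depth is \<open>1\<close> with the constant coefficient \<open>2 \<pi> \<i>\<close>; otherwise the function is
  modular, unless it vanishes identically.
\<close>

lemma quasimodular_form_higher_deriv_Eis1:
  assumes N: "pm_units N"
  shows "quasimodular_form (int (Suc k)) N (\<lambda>\<tau>. (deriv ^^ k) (Eis1 \<tau>) (1 / of_nat N))"
proof -
  define T where "T \<tau> = (deriv ^^ k) (Eis1 \<tau>) (1 / of_nat N)" for \<tau>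
  define s :: complex where "s = (-1) ^ Suc k"
  define h :: nat where "h = (if k = 1 then 1 else 0)"
  define G where "G j = (if j = 0 then T else (\<lambda>_. 2 * of_real pi * \<i>))" for j :: nat
  have N3: "N \<ge> 3" using N by (simp add: pm_units_def)
  have T_holo: "T holomorphic_on \<H>"
  proof -
    have "1 / real N \<notin> \<int>"
    proof
      assume "1 / real N \<in> \<int>"
      then obtain n :: int where n: "1 / real N = of_int n" by (elim Ints_cases)
      have "0 < 1 / real N" "1 / real N < 1" using N3 by simp_all
      thus False unfolding n by simp
    qed
    from holomorphic_higher_deriv_Eis1_torsion[OF this, of k] show ?thesis
      by (simp add: T_def[abs_def])
  qed
  have "quasimodular_of (int (Suc k)) h (sign_character N s) N T" if nz: "\<exists>\<tau>\<in>\<H>. T \<tau> \<noteq> 0"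
    unfolding quasimodular_of_def
  proof (intro conjI exI[of _ G] allI impI ballI; (clarify)?)
    show "T holomorphic_on \<H>" by (rule T_holo)
    show "G j holomorphic_on \<H>" for j using T_holo by (simp add: G_def)
    show "\<exists>\<tau>\<in>\<H>. G h \<tau> \<noteq> 0" using nz by (auto simp: G_def h_def)
  next
    fix a b c d \<tau> assume \<gamma>: "(a, b, c, d) \<in> Gamma0 N" and "\<tau> \<in> \<H>"
    hence \<tau>: "Im \<tau> > 0" by (simp add: upper_half_plane_def)
    obtain \<epsilon> :: int where \<epsilon>: "\<epsilon> = 1 \<or> \<epsilon> = -1" "int N dvd d - \<epsilon>"
      using Gamma0_obtain_sign[OF N \<gamma>] .
    have "sign_character N s d = of_int \<epsilon> ^ Suc k"
      using sign_character_eq[OF N3 \<epsilon>(2,1), of s] \<epsilon>(1) by (auto simp: s_def)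
    moreover have "T (moebius (a, b, c, d) \<tau>) = of_int \<epsilon> ^ Suc k * (of_int c * \<tau> + of_int d) ^ Suc k *
        (T \<tau> + (if k = 1 then 2 * of_real pi * \<i> * (of_int c / (of_int c * \<tau> + of_int d)) else 0))"
      unfolding T_def using N3 by (intro higher_deriv_Eis1_Gamma0 \<gamma> \<tau> \<epsilon>) simp
    ultimately show "T (moebius (a, b, c, d) \<tau>) = sign_character N s d *
        (of_int c * \<tau> + of_int d) powi (int (Suc k)) *
        (\<Sum>j\<le>h. G j \<tau> * (of_int c / (of_int c * \<tau> + of_int d)) ^ j)"
      by (simp add: power_int_of_nat G_def h_def del: of_nat_Suc power_Suc)
  next
    fix r a b c d assume r: "r \<le> h" and S: "(a, b, c, d) \<in> SL2Z"
    show "Bfun (\<lambda>\<tau>. (of_int c * \<tau> + of_int d) powi (- (int (Suc k) - 2 * int r)) *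
        G r (moebius (a, b, c, d) \<tau>)) (filtercomap Im at_top)"
    proof (cases "r = 0")
      case True
      thus ?thesis using Bfun_higher_deriv_Eis1_cusp[OF S, of N k] N3
        by (simp add: G_def T_def del: of_nat_Suc)
    next
      case False
      hence "k = 1" "r = 1" using r by (auto simp: h_def split: if_splits)
      thus ?thesis by (simp add: G_def)
    qed
  qed
  moreover have "dirichlet_character N (sign_character N s)"
    by (rule dirichlet_character_sign[OF N]) (simp add: s_def flip: power_mult_distrib)
  ultimately show ?thesis
    unfolding quasimodular_form_def T_def[symmetric] by blast
qed

section \<open>The generating functions\<close>

lemma MacMahon_U_0: "MacMahon_U 0 a q = 1"
proof -
  have "increasing_tuples 0 = {[]}" by (auto simp: increasing_tuples_def)
  thus ?thesis by (simp add: MacMahon_U_def)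
qed

text \<open>
  Induction on \<open>t\<close> along Newton's identities: the term \<open>U\<^sub>t\<^sub>-\<^sub>i P\<^sub>i\<close> has weight at most
  \<open>(t - i) + i = t\<close>.
\<close>

lemma quasimodular_lincomb_MacMahon_U:
  assumes N: "pm_units N"
  shows "quasimodular_lincomb (int t) N
    (\<lambda>\<tau>. MacMahon_U t (- 2 * cos (2 * of_real pi / of_nat N)) (e2pi \<tau>))"
proof (induction t rule: less_induct)
  case (less t)
  define a :: complex where "a = - 2 * cos (2 * of_real pi / of_nat N)"
  define x where "x = 1 / real N"
  have N3: "N \<ge> 3" using N by (simp add: pm_units_def)
  have const: "quasimodular_lincomb 0 N (\<lambda>_. c)" for c
    using quasimodular_lincomb_scale[OF quasimodular_lincomb_form[OF quasimodular_form_const[OF N]], of 0 c] by simp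
  have notin: "of_nat r / of_nat N \<notin> (\<int> :: complex set)" if "0 < r" "r < N" for r
  proof
    assume "of_nat r / of_nat N \<in> (\<int> :: complex set)"
    then obtain n :: int where "of_nat r / of_nat N = (of_int n :: complex)" by (elim Ints_cases)
    hence "complex_of_real (real r / real N) = of_real (of_int n)" by simp
    hence "real r / real N = of_int n" by (simp only: of_real_eq_iff)
    moreover have "0 < real r / real N" "real r / real N < 1" using that by simp_all
    ultimately show False by simp
  qed
  have x: "x \<notin> \<int>"
    using notin[of 1] N3 of_real_in_Ints_iff[of x, where ?'a = complex] by (simp add: x_def)
  have four_pi_sin: "four_pi_sin (of_real x) \<noteq> 0"
    using notin[of 2] N3 sin_pi_eq_0_iff[of "2 / of_nat N"] by (simp add: four_pi_sin_def x_def mult.commute)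
  have Eis1: "quasimodular_lincomb (int (Suc k)) N (\<lambda>\<tau>. (deriv ^^ k) (Eis1 \<tau>) (of_real x))" for k
    using quasimodular_lincomb_form[OF quasimodular_form_higher_deriv_Eis1[OF N, of k] order_refl]
    by (simp add: x_def)
  note P = quasimodular_lincomb_power_sum[OF x four_pi_sin const Eis1]
  show ?case
  proof (cases "t = 0")
    case True
    thus ?thesis using const by (simp add: MacMahon_U_0)
  next
    case False
    have U: "MacMahon_U k a q = (\<Sum>\<^sub>\<infinity>ns\<in>increasing_tuples k. prod_list (map (summand (of_real x) q) ns))" for k q
      unfolding MacMahon_U_eq summand_def[abs_def] by (simp add: a_def x_def)
    have "quasimodular_lincomb (int t) N (\<lambda>\<tau>. (1 / of_nat t) *
      (\<Sum>i<t. ((-1) ^ i * MacMahon_U (t - Suc i) a (e2pi \<tau>)) * power_sum (of_real x) (e2pi \<tau>) (Suc i)))"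
    proof (intro quasimodular_lincomb_scale quasimodular_lincomb_sum)
      fix i assume i: "i \<in> {..<t}"
      have "quasimodular_lincomb (int (t - Suc i) + int (Suc i)) N
        (\<lambda>\<tau>. ((-1) ^ i * MacMahon_U (t - Suc i) a (e2pi \<tau>)) * power_sum (of_real x) (e2pi \<tau>) (Suc i))"
        using less[of "t - Suc i"] i unfolding a_def
        by (intro quasimodular_lincomb_mult quasimodular_lincomb_scale P) auto
      thus "quasimodular_lincomb (int t) N
        (\<lambda>\<tau>. ((-1) ^ i * MacMahon_U (t - Suc i) a (e2pi \<tau>)) * power_sum (of_real x) (e2pi \<tau>) (Suc i))"
        using i by (simp add: of_nat_diff)
    qed
    thus ?thesis
      unfolding a_def[symmetric]
    proof (rule quasimodular_lincomb_cong)
      fix \<tau> assume "\<tau> \<in> \<H>"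
      hence strip: "in_strip (of_real x) (e2pi \<tau>)" by (simp add: in_strip_iff upper_half_plane_def)
      have "of_nat t * MacMahon_U t a (e2pi \<tau>) =
        (\<Sum>i<t. (-1) ^ i * MacMahon_U (t - Suc i) a (e2pi \<tau>) * power_sum (of_real x) (e2pi \<tau>) (Suc i))"
        unfolding U power_sum_def
      proof (rule newton_infsum)
        show "summable (\<lambda>n. norm (summand (of_real x) (e2pi \<tau>) (Suc n)))"
          using summable_norm_summand[OF strip, of 1] by simp
        show "summable (\<lambda>n. summand (of_real x) (e2pi \<tau>) (Suc n) ^ Suc i)" for i
          by (rule summable_norm_cancel[OF summable_norm_summand[OF strip zero_less_Suc]])
      qed
      thus "(1 / of_nat t) * (\<Sum>i<t. ((-1) ^ i * MacMahon_U (t - Suc i) a (e2pi \<tau>)) *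
          power_sum (of_real x) (e2pi \<tau>) (Suc i)) = MacMahon_U t a (e2pi \<tau>)"
        using False by (simp add: field_simps)
    qed
  qed
qed

lemma cos_2pi_div:
  "cos (2 * of_real pi / of_nat 4) = (0 :: complex)"
  "cos (2 * of_real pi / of_nat 3) = (- 1 / 2 :: complex)"
  "cos (2 * of_real pi / of_nat 6) = (1 / 2 :: complex)"
proof -
  have *: "cos (2 * of_real pi / of_nat n) = complex_of_real (cos (2 * pi / real n))" for n
  proof -
    have "2 * of_real pi / of_nat n = complex_of_real (2 * pi / real n)" by simp
    thus ?thesis by (simp only: cos_of_real)
  qed
  have r: "cos (2 * pi / real 4) = 0" "cos (2 * pi / real 3) = - 1 / 2" "cos (2 * pi / real 6) = 1 / 2"
    using cos_pi_half cos_120 cos_60 by (simp_all add: field_simps)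
  show "cos (2 * of_real pi / of_nat 4) = (0 :: complex)" unfolding * r by simp
  show "cos (2 * of_real pi / of_nat 3) = (- 1 / 2 :: complex)" unfolding * r by simp
  show "cos (2 * of_real pi / of_nat 6) = (1 / 2 :: complex)" unfolding * r by simp
qed

theorem corollary1p3:
  fixes t :: nat
  assumes "t \<ge> 1"
  shows "quasimodular_lincomb (int t) 4 (\<lambda>\<tau>. MacMahon_U t 0 (exp (2 * of_real pi * \<i> * \<tau>)))
       \<and> quasimodular_lincomb (int t) 3 (\<lambda>\<tau>. MacMahon_U t 1 (exp (2 * of_real pi * \<i> * \<tau>)))
       \<and> quasimodular_lincomb (int t) 6 (\<lambda>\<tau>. MacMahon_U t (-1) (exp (2 * of_real pi * \<i> * \<tau>)))"
  using quasimodular_lincomb_MacMahon_U[OF pm_units_3_4_6(1), of t]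
    quasimodular_lincomb_MacMahon_U[OF pm_units_3_4_6(2), of t]
    quasimodular_lincomb_MacMahon_U[OF pm_units_3_4_6(3), of t]
  unfolding cos_2pi_div e2pi_def by simp

end
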